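(* Let $C$ be a smooth projective curve of genus $g\ge2$ over $\mathbb C$, $X=\mathrm{Jac}^{g-1}_C$ with its theta divisor $\Theta$, $A=\mathrm{Jac}^0_C$, and let $N\geq 2$ be even. Choose a symplectic basis of $H_1(X,\mathbb Z)=H_1(A,\mathbb Z)$, with period matrix $\tau$, so that $A=\mathbb C^g/(\mathbb Z^g+\tau\mathbb Z^g)$, together with the level $(N,2N)$ structure that it determines. Let $\delta\in X$ be the even theta characteristic determined by the induced level $2$ structure and identify $X$ with $A$ by the isomorphism taking $\delta$ to $0$. Write points of $A[N]$ as $P=\tau a+b$ with $a,b\in(\frac1N\mathbb Z)^g/\mathbb Z^g$. (i) There is a normal Weil set $(\tilde f_P)_{P\in A[N]}$ on $(X,\Theta)$ such that, for $P=\tau a+b$, $$\tilde f_P=\left(\theta{-a\brack -b}(z,\tau)\Big/\theta{0\brack 0}(z,\tau)\right)^{N}.$$ (ii) Choose $w=(w_1,\dots,w_{3g-3})\in C^{3g-3}$ with $\sum w_i$ linearly equivalent to $K_C+\delta$. Then, regarding $\tilde f_P$ as a rational function on $C^{3g-3}$ by pullback under $C^{3g-3}\to\mathrm{Jac}^{3g-3}_C\cong X$ (abelian sum followed by subtraction of $K_C$), $$\tilde f_P(w)=\left(\theta{-a\brack -b}(0,\tau)\Big/\theta{0\brack 0}(0,\tau)\right)^{N}.$$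
   Context: For column vectors $a,b\in\mathbb R^g$ and $z\in\mathbb C^g$, $\theta{a\brack b}(z,\tau)=\sum_{n\in\mathbb Z^g}\exp\big(\pi i(2\,{}^t(n+a)(z+b)+{}^t(n+a)\tau(n+a))\big)$. $\Theta\subset X$ is the divisor of effective classes. By Riemann's theorem the isomorphism $X\to A$ sending $\delta$ to $0$ takes $\Theta$ to the zero locus of $\theta{0\brack0}(z,\tau)$; this characterizes $\delta$. For $P\in A$, $t_P$ is translation by $P$ on $X$, with the convention $(t_P^*f)(x)=f(x-P)$, and $\Theta_P=t_P^*\Theta$ is the translate of $\Theta$ by $P$. A Weil function (at level $N$) for $P\in A[N]$ is a rational function $f_P$ on $X$ with divisor $N\Theta_P-N\Theta$. A Weil set is a family $(f_P)_{P\in A[N]}$ of Weil functions. Given a bilinear pairing $d:A[N]\times A[N]\to\mu_N$ with $e_N(P,Q)=d(P,Q)/d(Q,P)$ ($e_N$ the Weil pairing), a Weil set $(\tilde f_P)$ is normal if $\tilde f_P\cdot t_P^*\tilde f_Q=d(P,Q)\tilde f_{P+Q}$ and $\tilde f_{-P}=t_{-P}^*\tilde f_P^{-1}$ for all $P,Q\in A[N]$. Here $d$ is the pairing $d(\tau a+b,\tau e+f)=\exp(2\pi iN\,{}^te\,b)$. (Weil functions are given explicitly on $C^{3g-3}$ by $f_P(z)=\det(\sigma_i^P(z_j))^N/\det(\sigma_i^0(z_j))^N$, where $\{\sigma_i^P\}$ is a basis of $H^0(C,\mathcal O(2K_C)\otimes P)$; the $\tilde f_P$ are scalar multiples of these.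)
   Formalization: The printed normality relations are inconsistent (they force d(P,-P)=1); here d(P,Q)=exp(-2πiN a·f), the inverse transpose of the printed d, and f_{-P}=d(P,-P) t_{-P}^*f_P^{-1}; (ii) assumes θ[0,0](0,τ)≠0; rational functions on X are taken as meromorphic functions. *)

theory Defs
  imports "HOL-Complex_Analysis.Complex_Analysis" "HOL-Library.Poly_Mapping"
begin

section \<open>Smooth projective curves over the complex numbers\<close>

text \<open>
  A point of projective space is a punctured line \<open>{c v | c \<noteq> 0}\<close> in \<open>complex^'n\<close>, where
  \<open>CARD('n)\<close> is the number of homogeneous coordinates.  Forms are homogeneous polynomial functions.
\<close>

definition ppoint :: "complex^'n \<Rightarrow> (complex^'n) set" where
  "ppoint v = {c *s v | c. c \<noteq> 0}"

definition proj_space :: "(complex^'n) set set" where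
  "proj_space = {ppoint v | v. v \<noteq> 0}"

definition hom_form :: "nat \<Rightarrow> (complex^'n \<Rightarrow> complex) \<Rightarrow> bool" where
  "hom_form d F \<longleftrightarrow> (\<exists>c :: ('n \<Rightarrow> nat) \<Rightarrow> complex.
     \<forall>v. F v = (\<Sum>\<alpha> | sum \<alpha> UNIV = d. c \<alpha> * (\<Prod>i\<in>UNIV. (v $ i) ^ \<alpha> i)))"

definition vanishing_forms :: "(complex^'n) set set \<Rightarrow> (complex^'n \<Rightarrow> complex) set" where
  "vanishing_forms C = {F. (\<exists>d. hom_form d F) \<and> (\<forall>p\<in>C. \<forall>v\<in>p. F v = 0)}"

definition algebraic_set :: "(complex^'n) set set \<Rightarrow> bool" where
  "algebraic_set Z \<longleftrightarrow> (\<exists>S \<subseteq> {F. \<exists>d. hom_form d F}.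
     Z = {p \<in> proj_space. \<forall>F\<in>S. \<forall>v\<in>p. F v = 0})"

definition irreducible_set :: "(complex^'n) set set \<Rightarrow> bool" where
  "irreducible_set Z \<longleftrightarrow> Z \<noteq> {} \<and>
     (\<forall>Z1 Z2. algebraic_set Z1 \<and> algebraic_set Z2 \<and> Z \<subseteq> Z1 \<union> Z2 \<longrightarrow> Z \<subseteq> Z1 \<or> Z \<subseteq> Z2)"

text \<open>
  The common kernel at \<open>v\<close> of the differentials of all forms vanishing on \<open>C\<close> is the Zariski tangent
  space of the affine cone; dimension 2 for the cone means that the Zariski tangent space of the
  (reduced) variety \<open>C\<close> has dimension 1 everywhere, i.e. \<open>C\<close> is smooth of pure dimension 1.
\<close>

definition smooth_projective_curve :: "(complex^'n) set set \<Rightarrow> bool" where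
  "smooth_projective_curve C \<longleftrightarrow> algebraic_set C \<and> irreducible_set C \<and>
     (\<forall>p\<in>C. \<forall>v\<in>p. vec.dim {x. \<forall>F\<in>vanishing_forms C. frechet_derivative F (at v) x = 0} = 2)"

text \<open>
  A rational function on \<open>C\<close> is given by a fraction \<open>F/G\<close> of forms of equal degree.  Orders are
  computed with a local analytic parametrization \<open>t \<mapsto> [\<gamma> t]\<close> (an immersion into projective space,
  so a local coordinate of \<open>C\<close>); they do not depend on its choice.
\<close>

definition rat_fun :: "(complex^'n) set set \<Rightarrow> (complex^'n \<Rightarrow> complex) \<Rightarrow> (complex^'n \<Rightarrow> complex) \<Rightarrow> bool" where
  "rat_fun C F G \<longleftrightarrow> (\<exists>d. hom_form d F \<and> hom_form d G) \<and> G \<notin> vanishing_forms C"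

definition local_param :: "(complex^'n) set set \<Rightarrow> (complex^'n) set \<Rightarrow> (complex \<Rightarrow> complex^'n) \<Rightarrow> bool" where
  "local_param C p \<gamma> \<longleftrightarrow> \<gamma> 0 \<in> p \<and>
     (\<exists>r>0. (\<forall>i. (\<lambda>t. \<gamma> t $ i) holomorphic_on ball 0 r) \<and>
            (\<forall>t\<in>ball 0 r. \<gamma> t \<noteq> 0 \<and> ppoint (\<gamma> t) \<in> C)) \<and>
     (\<forall>c. (\<chi> i. deriv (\<lambda>t. \<gamma> t $ i) 0) \<noteq> c *s \<gamma> 0)"

definition some_param :: "(complex^'n) set set \<Rightarrow> (complex^'n) set \<Rightarrow> complex \<Rightarrow> complex^'n" where
  "some_param C p = (SOME \<gamma>. local_param C p \<gamma>)"

definition ord_form :: "(complex^'n) set set \<Rightarrow> (complex^'n) set \<Rightarrow> (complex^'n \<Rightarrow> complex) \<Rightarrow> int" where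
  "ord_form C p F = zorder (\<lambda>t. F (some_param C p t)) 0"


section \<open>Divisors, divisor classes, canonical divisors and genus\<close>

type_synonym 'n divisor = "(complex^'n) set \<Rightarrow>\<^sub>0 int"

definition divisor_on :: "(complex^'n) set set \<Rightarrow> 'n divisor \<Rightarrow> bool" where
  "divisor_on C D \<longleftrightarrow> Poly_Mapping.keys D \<subseteq> C"

definition div_degree :: "'n divisor \<Rightarrow> int" where
  "div_degree D = (\<Sum>p\<in>Poly_Mapping.keys D. Poly_Mapping.lookup D p)"

definition effective :: "'n divisor \<Rightarrow> bool" where
  "effective D \<longleftrightarrow> (\<forall>p. 0 \<le> Poly_Mapping.lookup D p)"

abbreviation point_divisor :: "(complex^'n) set \<Rightarrow> 'n divisor" where
  "point_divisor p \<equiv> Poly_Mapping.single p 1"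

definition principal_divisor :: "(complex^'n) set set \<Rightarrow> 'n divisor \<Rightarrow> bool" where
  "principal_divisor C D \<longleftrightarrow> divisor_on C D \<and>
     (\<exists>F G. rat_fun C F G \<and> F \<notin> vanishing_forms C \<and>
        (\<forall>p\<in>C. Poly_Mapping.lookup D p = ord_form C p F - ord_form C p G))"

definition div_class :: "(complex^'n) set set \<Rightarrow> 'n divisor \<Rightarrow> 'n divisor set" where
  "div_class C D = {D'. divisor_on C D' \<and> principal_divisor C (D' - D)}"

definition Jac :: "(complex^'n) set set \<Rightarrow> int \<Rightarrow> 'n divisor set set" where
  "Jac C d = {div_class C D | D. divisor_on C D \<and> div_degree D = d}"

definition cls_add :: "'n divisor set \<Rightarrow> 'n divisor set \<Rightarrow> 'n divisor set" where
  "cls_add x y = {D + E | D E. D \<in> x \<and> E \<in> y}"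

definition cls_diff :: "'n divisor set \<Rightarrow> 'n divisor set \<Rightarrow> 'n divisor set" where
  "cls_diff x y = {D - E | D E. D \<in> x \<and> E \<in> y}"

text \<open>\<open>K\<close> is the divisor of the nonzero rational differential form \<open>(F/G) d(H/M)\<close>.\<close>

definition canonical_divisor :: "(complex^'n) set set \<Rightarrow> 'n divisor \<Rightarrow> bool" where
  "canonical_divisor C K \<longleftrightarrow> divisor_on C K \<and>
     (\<exists>F G H M. rat_fun C F G \<and> F \<notin> vanishing_forms C \<and> rat_fun C H M \<and>
        (\<forall>c. (\<lambda>v. H v - c * M v) \<notin> vanishing_forms C) \<and>
        (\<forall>p\<in>C. Poly_Mapping.lookup K p =
           zorder (\<lambda>t. let \<gamma> = some_param C p in
                    F (\<gamma> t) / G (\<gamma> t) * deriv (\<lambda>s. H (\<gamma> s) / M (\<gamma> s)) t) 0))"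

definition in_RR_space ::
  "(complex^'n) set set \<Rightarrow> 'n divisor \<Rightarrow> (complex^'n \<Rightarrow> complex) \<Rightarrow> (complex^'n \<Rightarrow> complex) \<Rightarrow> bool" where
  "in_RR_space C D F G \<longleftrightarrow> rat_fun C F G \<and>
     (F \<in> vanishing_forms C \<or>
      (\<forall>p\<in>C. 0 \<le> ord_form C p F - ord_form C p G + Poly_Mapping.lookup D p))"

text \<open>
  \<open>h\<^sup>0(O(D)) = n\<close>: the space of rational functions \<open>f\<close> with \<open>f = 0\<close> or \<open>div f + D \<ge> 0\<close> has a basis
  \<open>F 0/G 0, \<dots>, F (n-1)/G (n-1)\<close>.  Equality of rational functions is tested where all denominators
  are nonzero.
\<close>

definition h0_eq :: "(complex^'n) set set \<Rightarrow> 'n divisor \<Rightarrow> nat \<Rightarrow> bool" where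
  "h0_eq C D n \<longleftrightarrow> (\<exists>F G :: nat \<Rightarrow> complex^'n \<Rightarrow> complex.
     (\<forall>i<n. in_RR_space C D (F i) (G i)) \<and>
     (\<forall>F' G'. in_RR_space C D F' G' \<longrightarrow>
        (\<exists>!c :: nat \<Rightarrow> complex. (\<forall>i\<ge>n. c i = 0) \<and>
           (\<forall>p\<in>C. \<forall>v\<in>p. G' v \<noteq> 0 \<and> (\<forall>i<n. G i v \<noteq> 0) \<longrightarrow>
              F' v / G' v = (\<Sum>i<n. c i * (F i v / G i v))))))"

definition has_genus :: "(complex^'n) set set \<Rightarrow> nat \<Rightarrow> bool" where
  "has_genus C g \<longleftrightarrow> (\<exists>K. canonical_divisor C K \<and> h0_eq C K g)"

text \<open>The condition depends only on the class \<open>\<delta>\<close>.\<close>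

definition even_theta_characteristic ::
  "(complex^'n) set set \<Rightarrow> 'n divisor \<Rightarrow> 'n divisor set \<Rightarrow> bool" where
  "even_theta_characteristic C K \<delta> \<longleftrightarrow> cls_add \<delta> \<delta> = div_class C K \<and>
     (\<exists>D\<in>\<delta>. \<exists>n. even n \<and> h0_eq C D n)"

definition Theta_divisor :: "(complex^'n) set set \<Rightarrow> nat \<Rightarrow> 'n divisor set set" where
  "Theta_divisor C g = {div_class C D | D. divisor_on C D \<and> effective D \<and> div_degree D = int g - 1}"


section \<open>Several complex variables\<close>

definition holo_on :: "(complex^'g \<Rightarrow> complex) \<Rightarrow> (complex^'g) set \<Rightarrow> bool" where
  "holo_on f U \<longleftrightarrow>
     (\<forall>z\<in>U. \<exists>L. (f has_derivative L) (at z) \<and> (\<forall>c v. L (c *s v) = c * L v))"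

text \<open>
  \<open>h\<close> is a local equation on the open set \<open>U\<close> of the reduced divisor \<open>S\<close>: its zero set is \<open>S\<close>, and it
  generates the ideal of holomorphic functions vanishing on \<open>S\<close>.
\<close>

definition reduced_equation :: "(complex^'g) set \<Rightarrow> (complex^'g) set \<Rightarrow> (complex^'g \<Rightarrow> complex) \<Rightarrow> bool" where
  "reduced_equation S U h \<longleftrightarrow> open U \<and> holo_on h U \<and> (\<forall>w\<in>U. h w = 0 \<longleftrightarrow> w \<in> S) \<and>
     (\<forall>V k w. open V \<and> V \<subseteq> U \<and> w \<in> V \<and> holo_on k V \<and> (\<forall>x\<in>V \<inter> S. k x = 0) \<longrightarrow>
        (\<exists>W q. open W \<and> w \<in> W \<and> W \<subseteq> V \<and> holo_on q W \<and> (\<forall>x\<in>W. k x = q x * h x)))"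

text \<open>
  A meromorphic function is a partial function whose domain is exactly its set of regular points.
\<close>

definition meromorphic_map :: "(complex^'g \<Rightarrow> complex option) \<Rightarrow> bool" where
  "meromorphic_map F \<longleftrightarrow>
     (\<forall>z. \<exists>U h k. open U \<and> z \<in> U \<and> holo_on h U \<and> holo_on k U \<and>
        (\<forall>V. open V \<and> V \<noteq> {} \<and> V \<subseteq> U \<longrightarrow> (\<exists>w\<in>V. k w \<noteq> 0)) \<and>
        (\<forall>w\<in>U. k w \<noteq> 0 \<longrightarrow> F w = Some (h w / k w))) \<and>
     (\<forall>z c. F z = Some c \<longleftrightarrow>
        (\<exists>U h. open U \<and> z \<in> U \<and> holo_on h U \<and> h z = c \<and> (\<forall>w\<in>U. F w \<in> {None, Some (h w)})))"


section \<open>The Jacobian as a complex torus\<close>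

text \<open>
  The universal covering \<open>\<pi>\<close> of the complex torus \<open>Jac\<^sup>0\<close>.  The complex structure of \<open>Jac\<^sup>0\<close> is the one
  for which the maps \<open>p \<mapsto> [p - q]\<close> from the curve are holomorphic, which is unique.  The kernel of
  \<open>\<pi>\<close> is \<open>H\<^sub>1(A,\<int>)\<close>, and \<open>H\<^sub>1(X,\<int>) = H\<^sub>1(A,\<int>)\<close> since \<open>X\<close> is a torsor under \<open>A\<close>.
\<close>

definition jacobian_uniformization ::
  "(complex^'n) set set \<Rightarrow> (complex^'g \<Rightarrow> 'n divisor set) \<Rightarrow> bool" where
  "jacobian_uniformization C \<pi> \<longleftrightarrow>
     range \<pi> = Jac C 0 \<and>
     (\<forall>z w. \<pi> (z + w) = cls_add (\<pi> z) (\<pi> w)) \<and>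
     (\<exists>r>0. \<forall>z. \<pi> z = \<pi> 0 \<and> norm z < r \<longrightarrow> z = 0) \<and>
     (\<forall>p\<in>C. \<forall>q\<in>C. \<forall>\<gamma>. local_param C p \<gamma> \<longrightarrow>
        (\<exists>r>0. \<exists>\<phi> :: complex \<Rightarrow> complex^'g. (\<forall>i. (\<lambda>t. \<phi> t $ i) holomorphic_on ball 0 r) \<and>
           (\<forall>t\<in>ball 0 r. \<pi> (\<phi> t) = div_class C (point_divisor (ppoint (\<gamma> t)) - point_divisor q))))"

text \<open>
  The polarization defined by \<open>\<Theta>\<close>: the Riemann form \<open>E\<close> on \<open>H\<^sub>1(A,\<int>)\<close> (extended to the universal
  covering) such that the pullback of a translate of \<open>\<Theta>\<close> has a global equation transforming by an
  Appell-Humbert factor of automorphy \<open>\<alpha>(l) exp(\<pi> H(z,l) + \<pi>/2 H(l,l))\<close>, where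
  \<open>H(u,v) = E(iu,v) + i E(u,v)\<close>; that is, \<open>E = c\<^sub>1(O(\<Theta>))\<close>.
\<close>

definition theta_polarization ::
  "(complex^'n) set set \<Rightarrow> (complex^'g \<Rightarrow> 'n divisor set) \<Rightarrow>
   (complex^'g \<Rightarrow> complex^'g \<Rightarrow> real) \<Rightarrow> bool" where
  "theta_polarization C \<pi> E \<longleftrightarrow>
     bilinear E \<and> (\<forall>u. E u u = 0) \<and> (\<forall>u v. E (\<i> *s u) (\<i> *s v) = E u v) \<and>
     (\<forall>u. u \<noteq> 0 \<longrightarrow> E (\<i> *s u) u > 0) \<and>
     (\<forall>l m. \<pi> l = \<pi> 0 \<and> \<pi> m = \<pi> 0 \<longrightarrow> E l m \<in> \<int>) \<and>
     (let H = (\<lambda>u v. complex_of_real (E (\<i> *s u) v) + \<i> * complex_of_real (E u v)) in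
      \<exists>x\<in>Jac C (int CARD('g) - 1). \<exists>h \<alpha>.
        reduced_equation {z. cls_add x (\<pi> z) \<in> Theta_divisor C CARD('g)} UNIV h \<and>
        (\<forall>l z. \<pi> l = \<pi> 0 \<longrightarrow> norm (\<alpha> l :: complex) = 1 \<and>
           h (z + l) = \<alpha> l * exp (of_real pi * H z l + of_real pi / 2 * H l l) * h z))"

text \<open>The point \<open>\<tau>a + b\<close>.\<close>

definition period_pt :: "complex^'g^'g \<Rightarrow> real^'g \<Rightarrow> real^'g \<Rightarrow> complex^'g" where
  "period_pt \<tau> a b = (\<chi> i. (\<Sum>j\<in>UNIV. \<tau> $ i $ j * of_real (a $ j)) + of_real (b $ i))"

text \<open>
  Coordinates on the universal covering are normalized by a symplectic basis: the columns of \<open>\<tau>\<close>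
  and the standard unit vectors form a basis of \<open>H\<^sub>1(A,\<int>)\<close> that is symplectic for \<open>E\<close>.  With this
  sign of \<open>E\<close>, positivity of the polarization says that the imaginary part of \<open>\<tau>\<close> is positive.
\<close>

definition symplectic_period_matrix ::
  "(complex^'g \<Rightarrow> 'n divisor set) \<Rightarrow> (complex^'g \<Rightarrow> complex^'g \<Rightarrow> real) \<Rightarrow> complex^'g^'g \<Rightarrow> bool" where
  "symplectic_period_matrix \<pi> E \<tau> \<longleftrightarrow>
     {z. \<pi> z = \<pi> 0} = {period_pt \<tau> a b | a b. \<forall>i. a $ i \<in> \<int> \<and> b $ i \<in> \<int>} \<and>
     (\<forall>i j. E (period_pt \<tau> (axis i 1) 0) (period_pt \<tau> (axis j 1) 0) = 0 \<and>
            E (period_pt \<tau> 0 (axis i 1)) (period_pt \<tau> 0 (axis j 1)) = 0 \<and>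
            E (period_pt \<tau> (axis i 1) 0) (period_pt \<tau> 0 (axis j 1)) = (if i = j then 1 else 0))"

definition theta_char :: "real^'g \<Rightarrow> real^'g \<Rightarrow> complex^'g \<Rightarrow> complex^'g^'g \<Rightarrow> complex" where
  "theta_char a b z \<tau> = (\<Sum>\<^sub>\<infinity>n\<in>(UNIV :: (int^'g) set).
     exp (of_real pi * \<i> *
       (2 * (\<Sum>i\<in>UNIV. of_real (of_int (n $ i) + a $ i) * (z $ i + of_real (b $ i))) +
        (\<Sum>i\<in>UNIV. \<Sum>j\<in>UNIV. of_real (of_int (n $ i) + a $ i) * \<tau> $ i $ j
                                 * of_real (of_int (n $ j) + a $ j)))))"

text \<open>
  \<open>z \<mapsto> \<delta> + \<pi>(z)\<close> is the covering of \<open>X\<close> belonging to the identification of \<open>X\<close> with \<open>A\<close> that takes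
  \<open>\<delta>\<close> to \<open>0\<close>.
\<close>

definition X_cover ::
  "(complex^'g \<Rightarrow> 'n divisor set) \<Rightarrow> 'n divisor set \<Rightarrow> complex^'g \<Rightarrow> 'n divisor set" where
  "X_cover \<pi> \<delta> z = cls_add \<delta> (\<pi> z)"

text \<open>The characterization of \<open>\<delta>\<close>, with the zero locus of the theta function taken as a divisor.\<close>

definition riemann_theta_characteristic ::
  "(complex^'n) set set \<Rightarrow> (complex^'g \<Rightarrow> 'n divisor set) \<Rightarrow> complex^'g^'g \<Rightarrow> 'n divisor set \<Rightarrow> bool" where
  "riemann_theta_characteristic C \<pi> \<tau> \<delta> \<longleftrightarrow>
     reduced_equation {z. X_cover \<pi> \<delta> z \<in> Theta_divisor C CARD('g)} UNIV (\<lambda>z. theta_char 0 0 z \<tau>)"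


section \<open>Rational functions on \<open>X\<close> and Weil sets\<close>

text \<open>
  Rational functions on the projective variety \<open>X\<close> are its meromorphic functions (Chow).
  Their domains are dense and open, so that two of them are equal if they agree wherever both
  are defined.
\<close>

type_synonym 'n jac_fun = "'n divisor set \<Rightarrow> complex option"

definition rational_on_X ::
  "(complex^'g \<Rightarrow> 'n divisor set) \<Rightarrow> 'n divisor set \<Rightarrow> 'n jac_fun \<Rightarrow> bool" where
  "rational_on_X \<pi> \<delta> f \<longleftrightarrow> dom f \<subseteq> range (X_cover \<pi> \<delta>) \<and> meromorphic_map (\<lambda>z. f (X_cover \<pi> \<delta> z))"

definition rat_agree :: "'n jac_fun \<Rightarrow> 'n jac_fun \<Rightarrow> bool" where
  "rat_agree f h \<longleftrightarrow> (\<forall>x\<in>dom f \<inter> dom h. f x = h x)"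

definition rat_mult :: "'n jac_fun \<Rightarrow> 'n jac_fun \<Rightarrow> 'n jac_fun" where
  "rat_mult f h = (\<lambda>x. case f x of None \<Rightarrow> None | Some c \<Rightarrow> map_option ((*) c) (h x))"

definition rat_scale :: "complex \<Rightarrow> 'n jac_fun \<Rightarrow> 'n jac_fun" where
  "rat_scale c f = (\<lambda>x. map_option ((*) c) (f x))"

definition rat_inverse :: "'n jac_fun \<Rightarrow> 'n jac_fun" where
  "rat_inverse f = (\<lambda>x. case f x of None \<Rightarrow> None
                       | Some c \<Rightarrow> if c = 0 then None else Some (inverse c))"

definition translate_fun :: "'n divisor set \<Rightarrow> 'n jac_fun \<Rightarrow> 'n jac_fun" where
  "translate_fun P f = (\<lambda>x. f (cls_diff x P))"

definition translate_set :: "'n divisor set \<Rightarrow> 'n divisor set set \<Rightarrow> 'n divisor set set" where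
  "translate_set P S = {x. cls_diff x P \<in> S}"

definition jac_torsion ::
  "nat \<Rightarrow> (complex^'g \<Rightarrow> 'n divisor set) \<Rightarrow> 'n divisor set set" where
  "jac_torsion N \<pi> = {\<pi> z | z. \<pi> (of_nat N *s z) = \<pi> 0}"

text \<open>The divisor of \<open>f\<close> is \<open>N\<Theta>\<^sub>P - N\<Theta>\<close>, expressed by local equations.\<close>

definition weil_function ::
  "(complex^'n) set set \<Rightarrow> (complex^'g \<Rightarrow> 'n divisor set) \<Rightarrow> 'n divisor set \<Rightarrow> nat \<Rightarrow>
   'n divisor set \<Rightarrow> 'n jac_fun \<Rightarrow> bool" where
  "weil_function C \<pi> \<delta> N P f \<longleftrightarrow> rational_on_X \<pi> \<delta> f \<and>
     (let \<Theta> = Theta_divisor C CARD('g) in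
      \<forall>z. \<exists>U h1 h0 e. z \<in> U \<and>
        reduced_equation {w. X_cover \<pi> \<delta> w \<in> translate_set P \<Theta>} U h1 \<and>
        reduced_equation {w. X_cover \<pi> \<delta> w \<in> \<Theta>} U h0 \<and>
        holo_on e U \<and> (\<forall>w\<in>U. e w \<noteq> 0) \<and>
        (\<forall>w\<in>U. h0 w \<noteq> 0 \<longrightarrow> f (X_cover \<pi> \<delta> w) = Some (e w * h1 w ^ N / h0 w ^ N)))"

definition weil_set ::
  "(complex^'n) set set \<Rightarrow> (complex^'g \<Rightarrow> 'n divisor set) \<Rightarrow> 'n divisor set \<Rightarrow> nat \<Rightarrow>
   ('n divisor set \<Rightarrow> 'n jac_fun) \<Rightarrow> bool" where
  "weil_set C \<pi> \<delta> N f \<longleftrightarrow> (\<forall>P\<in>jac_torsion N \<pi>. weil_function C \<pi> \<delta> N P (f P))"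

text \<open>
  \<open>d\<close> is a bilinear pairing \<open>A[N] \<times> A[N] \<rightarrow> \<mu>\<^sub>N\<close> with \<open>e\<^sub>N(P,Q) = d(P,Q)/d(Q,P)\<close>, where the Weil pairing
  of the principal polarization is \<open>e\<^sub>N(\<pi>(u),\<pi>(v)) = exp(-2\<pi>i N E(u,v))\<close>, i.e.
  \<open>exp(2\<pi>i N (e\<cdot>b - a\<cdot>f))\<close> for \<open>u = \<tau>a + b\<close>, \<open>v = \<tau>e + f\<close>.
\<close>

definition splits_weil_pairing ::
  "(complex^'g \<Rightarrow> 'n divisor set) \<Rightarrow> (complex^'g \<Rightarrow> complex^'g \<Rightarrow> real) \<Rightarrow> nat \<Rightarrow>
   ('n divisor set \<Rightarrow> 'n divisor set \<Rightarrow> complex) \<Rightarrow> bool" where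
  "splits_weil_pairing \<pi> E N d \<longleftrightarrow>
     (\<forall>P\<in>jac_torsion N \<pi>. \<forall>Q\<in>jac_torsion N \<pi>. d P Q ^ N = 1 \<and>
        (\<forall>R\<in>jac_torsion N \<pi>. d (cls_add P Q) R = d P R * d Q R \<and>
                            d R (cls_add P Q) = d R P * d R Q)) \<and>
     (\<forall>u v. \<pi> u \<in> jac_torsion N \<pi> \<and> \<pi> v \<in> jac_torsion N \<pi> \<longrightarrow>
        exp (- 2 * of_real pi * \<i> * of_nat N * of_real (E u v)) = d (\<pi> u) (\<pi> v) / d (\<pi> v) (\<pi> u))"

text \<open>
  Normality.  The first relation at \<open>P = Q = 0\<close> gives \<open>f\<^sub>0 = 1\<close>, and at \<open>Q = -P\<close> it then gives
  \<open>f\<^bsub>-P\<^esub> = d(P,-P) t\<^bsub>-P\<^esub>\<^sup>* f\<^sub>P\<^sup>-\<^sup>1\<close>.  The scalar \<open>d(P,-P)\<close> is therefore kept in the second relation: without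
  it the two relations are contradictory unless \<open>d(P,P) = 1\<close> for all \<open>P\<close>.
\<close>

definition normal_weil_set ::
  "(complex^'n) set set \<Rightarrow> (complex^'g \<Rightarrow> 'n divisor set) \<Rightarrow> (complex^'g \<Rightarrow> complex^'g \<Rightarrow> real) \<Rightarrow>
   'n divisor set \<Rightarrow> nat \<Rightarrow> ('n divisor set \<Rightarrow> 'n divisor set \<Rightarrow> complex) \<Rightarrow>
   ('n divisor set \<Rightarrow> 'n jac_fun) \<Rightarrow> bool" where
  "normal_weil_set C \<pi> E \<delta> N d f \<longleftrightarrow> weil_set C \<pi> \<delta> N f \<and> splits_weil_pairing \<pi> E N d \<and>
     (\<forall>P\<in>jac_torsion N \<pi>. \<forall>Q\<in>jac_torsion N \<pi>.
        rat_agree (rat_mult (f P) (translate_fun P (f Q))) (rat_scale (d P Q) (f (cls_add P Q)))) \<and>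
     (\<forall>P\<in>jac_torsion N \<pi>. let P' = cls_diff (\<pi> 0) P in
        rat_agree (f P') (rat_scale (d P P') (rat_inverse (translate_fun P' (f P)))))"

definition level_coord :: "nat \<Rightarrow> real^'g \<Rightarrow> bool" where
  "level_coord N a \<longleftrightarrow> (\<forall>i. of_nat N * a $ i \<in> \<int>)"

text \<open>
  The pairing \<open>d(\<tau>a + b, \<tau>e + f) = exp(2\<pi>i N e\<cdot>b)\<close>.  For the theta quotients one computes
  \<open>f\<^sub>P \<cdot> t\<^sub>P\<^sup>* f\<^sub>Q = exp(-2\<pi>i N a\<cdot>f) f\<^bsub>P+Q\<^esub>\<close>, whose scalar is \<open>d(Q,P)\<^sup>-\<^sup>1\<close> and not \<open>d(P,Q)\<close>;
  both pairings split \<open>e\<^sub>N\<close>.  So they are normal for the pairing \<open>d_transp\<close>.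
\<close>

definition d_pairing ::
  "(complex^'g \<Rightarrow> 'n divisor set) \<Rightarrow> complex^'g^'g \<Rightarrow> nat \<Rightarrow> 'n divisor set \<Rightarrow> 'n divisor set \<Rightarrow> complex" where
  "d_pairing \<pi> \<tau> N P Q = (THE c. \<exists>a b e f.
     level_coord N a \<and> level_coord N b \<and> level_coord N e \<and> level_coord N f \<and>
     P = \<pi> (period_pt \<tau> a b) \<and> Q = \<pi> (period_pt \<tau> e f) \<and>
     c = exp (2 * of_real pi * \<i> * of_nat N * of_real (e \<bullet> b)))"

definition d_transp ::
  "(complex^'g \<Rightarrow> 'n divisor set) \<Rightarrow> complex^'g^'g \<Rightarrow> nat \<Rightarrow> 'n divisor set \<Rightarrow> 'n divisor set \<Rightarrow> complex" where
  "d_transp \<pi> \<tau> N P Q = inverse (d_pairing \<pi> \<tau> N Q P)"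

text \<open>
  Pullback along \<open>C\<^sup>m \<rightarrow> Jac\<^sup>m \<cong> X\<close>, abelian sum followed by subtraction of \<open>K\<close>; points of \<open>C\<^sup>m\<close> are
  lists of length \<open>m\<close>.
\<close>

definition sum_class :: "(complex^'n) set set \<Rightarrow> (complex^'n) set list \<Rightarrow> 'n divisor set" where
  "sum_class C w = div_class C (\<Sum>p\<leftarrow>w. point_divisor p)"

definition sum_pullback ::
  "(complex^'n) set set \<Rightarrow> 'n divisor \<Rightarrow> 'n jac_fun \<Rightarrow> (complex^'n) set list \<Rightarrow> complex option" where
  "sum_pullback C K f w = f (cls_diff (sum_class C w) (div_class C K))"

end

theory Submission
  imports Defs
begin

text \<open>Holomorphy of \<theta> comes with the characterization of \<delta>, since
  \<open>reduced_equation\<close> contains it. Non-vanishing does not: the zero function is a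
  reduced equation of the whole space. It therefore has to come from the series itself, which is why
  convergence and an averaging argument are needed. The definition of rational functions shapes the
  rest. The domain of a \<open>meromorphic_map\<close> is exactly its set of regular points, so a
  quotient defined only off the zeros of \<theta> does not qualify: for P = 0 it is the constant 1,
  also on \<Theta>. Hence every identity is stated for values of holomorphic germs and proved where
  the denominators do not vanish. The exponent N has one purpose. Changing the lift of P or of the
  point of X multiplies the theta quotient by numbers exp(2 pi i r) with N r an integer, and only
  the N-th power is insensitive to them. Closure of principal divisors under addition is taken from
  the additivity of \<pi>. Multiplying fractions instead would require orders of products along the
  chosen local parametrizations.\<close>

text \<open>
  Since \<open>\<pi>(0) + \<pi>(0) = \<pi>(0)\<close> and principal divisors are closed under negation, they form a group, so
  classes can be added and subtracted through representatives.  The Riemann relations for \<open>\<tau>\<close> follow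
  from evaluating the Riemann form on the vectors \<open>i Im(\<tau>) x\<close>; hence the theta series converges and
  does not vanish identically.  By \<open>\<theta>[-a,-b](z) = exp(\<pi>i(a\<cdot>\<tau>a - 2a\<cdot>(z - b))) \<theta>(z - \<tau>a - b)\<close>, the \<open>N\<close>-th
  power of the theta quotient has divisor \<open>N\<Theta>\<^sub>P - N\<Theta>\<close>, is periodic, and depends only on the class of \<open>P\<close>.
  Extending it to all of its regular points gives a meromorphic function, and the normality relations,
  which are identities of exponentials off the zeros of \<open>\<theta>\<close>, extend by density.
\<close>

section \<open>Divisor classes\<close>

lemma ppoint_self: "v \<in> ppoint v"
  by (force simp: ppoint_def intro: exI[of _ 1])

lemma hom_form_one: "hom_form 0 (\<lambda>v::complex^'n. 1)"
proof -
  have "{\<alpha> :: 'n \<Rightarrow> nat. sum \<alpha> UNIV = 0} = {\<lambda>_. 0}" by auto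
  then show ?thesis by (auto simp: hom_form_def intro!: exI[of _ "\<lambda>_. 1"])
qed

lemma one_not_vanishing:
  assumes "smooth_projective_curve C"
  shows "(\<lambda>v. 1) \<notin> vanishing_forms C"
proof -
  obtain p where "p \<in> C" "p \<in> proj_space"
    using assms by (auto simp: smooth_projective_curve_def irreducible_set_def algebraic_set_def)
  then show ?thesis
    using ppoint_self by (fastforce simp: vanishing_forms_def proj_space_def)
qed

lemma principal_divisor_0:
  assumes "smooth_projective_curve C"
  shows "principal_divisor C 0"
  unfolding principal_divisor_def divisor_on_def rat_fun_def
  using one_not_vanishing[OF assms] hom_form_one
  by (auto intro!: exI[of _ "\<lambda>_. 1"])

lemma principal_divisor_uminus:
  assumes "principal_divisor C D"
  shows "principal_divisor C (- D)"
proof -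
  obtain F G where "rat_fun C F G" "F \<notin> vanishing_forms C"
    "\<forall>p\<in>C. Poly_Mapping.lookup D p = ord_form C p F - ord_form C p G"
    using assms by (auto simp: principal_divisor_def)
  then have "rat_fun C G F \<and> G \<notin> vanishing_forms C \<and>
    (\<forall>p\<in>C. Poly_Mapping.lookup (- D) p = ord_form C p G - ord_form C p F)"
    by (auto simp: rat_fun_def)
  then show ?thesis
    using assms unfolding principal_divisor_def divisor_on_def by auto
qed

lemma divisor_on_0: "divisor_on C 0"
  by (simp add: divisor_on_def)

lemma divisor_on_add: "divisor_on C D \<Longrightarrow> divisor_on C E \<Longrightarrow> divisor_on C (D + E)"
  unfolding divisor_on_def using Poly_Mapping.keys_add[of D E] by blast

lemma divisor_on_diff: "divisor_on C D \<Longrightarrow> divisor_on C E \<Longrightarrow> divisor_on C (D - E)"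
  unfolding divisor_on_def using keys_diff[of D E] by blast

lemma div_class_eq:
  assumes "divisor_on C D"
  shows "div_class C D = {D + E | E. principal_divisor C E}"
proof -
  have "\<exists>E. D' = D + E \<and> principal_divisor C E" if "principal_divisor C (D' - D)" for D'
    using that by (intro exI[of _ "D' - D"]) simp
  moreover have "divisor_on C (D + E)" if "principal_divisor C E" for E
    using that divisor_on_add[OF assms] by (simp add: principal_divisor_def)
  moreover have "divisor_on C D'" if "principal_divisor C (D' - D)" for D'
    using that divisor_on_add[OF assms, of "D' - D"] by (simp add: principal_divisor_def)
  ultimately show ?thesis
    unfolding div_class_def by auto
qed

section \<open>Adding and subtracting classes through representatives\<close>

context
  fixes C :: "(complex^'n) set set"
  assumes zero: "principal_divisor C 0"
    and add: "\<And>D E. principal_divisor C D \<Longrightarrow> principal_divisor C E \<Longrightarrow> principal_divisor C (D + E)"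
begin

lemma cls_add_div_class:
  assumes "divisor_on C D" "divisor_on C E"
  shows "cls_add (div_class C D) (div_class C E) = div_class C (D + E)"
proof -
  have "\<exists>F G. D + E + H = (D + F) + (E + G) \<and> principal_divisor C F \<and> principal_divisor C G"
    if "principal_divisor C H" for H
    using that zero by (intro exI[of _ H] exI[of _ 0]) simp
  moreover have "\<exists>H. (D + F) + (E + G) = D + E + H \<and> principal_divisor C H"
    if "principal_divisor C F" "principal_divisor C G" for F G
    using that add by (intro exI[of _ "F + G"]) (simp add: algebra_simps)
  ultimately show ?thesis
    unfolding cls_add_def div_class_eq[OF assms(1)] div_class_eq[OF assms(2)]
      div_class_eq[OF divisor_on_add[OF assms]] by blast
qed

lemma cls_diff_div_class:
  assumes "divisor_on C D" "divisor_on C E"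
  shows "cls_diff (div_class C D) (div_class C E) = div_class C (D - E)"
proof -
  have "\<exists>F G. D - E + H = (D + F) - (E + G) \<and> principal_divisor C F \<and> principal_divisor C G"
    if "principal_divisor C H" for H
    using that zero by (intro exI[of _ H] exI[of _ 0]) simp
  moreover have "\<exists>H. (D + F) - (E + G) = D - E + H \<and> principal_divisor C H"
    if "principal_divisor C F" "principal_divisor C G" for F G
    using that(1) add[OF that(1) principal_divisor_uminus[OF that(2)]]
    by (intro exI[of _ "F + - G"]) (simp add: algebra_simps)
  ultimately show ?thesis
    unfolding cls_diff_def div_class_eq[OF assms(1)] div_class_eq[OF assms(2)]
      div_class_eq[OF divisor_on_diff[OF assms]] by blast
qed

lemma div_class_eq_iff:
  assumes "divisor_on C D" "divisor_on C E"
  shows "div_class C D = div_class C E \<longleftrightarrow> principal_divisor C (D - E)"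
proof
  assume "div_class C D = div_class C E"
  moreover have "D \<in> div_class C D"
    using assms zero by (simp add: div_class_def)
  ultimately show "principal_divisor C (D - E)"
    by (simp add: div_class_def)
next
  assume *: "principal_divisor C (D - E)"
  have "principal_divisor C (E - D)"
    using principal_divisor_uminus[OF *] by simp
  then have "principal_divisor C (F - D) \<longleftrightarrow> principal_divisor C (F - E)" for F
    using add[of "F - D" "D - E"] add[of "F - E" "E - D"] * by auto
  then show "div_class C D = div_class C E"
    by (simp add: div_class_def)
qed

end

text \<open>The class \<open>\<pi> 0\<close> of \<open>D0\<close> is idempotent, so (D0 + F) + (D0 +
  G) lies again in the class of \<open>D0\<close> for principal F and G. Subtracting
  \<open>D0\<close> leaves a principal divisor, which is the claim up to the stray summand
  \<open>D0\<close>.\<close>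

lemma jacobian_principal_add:
  assumes curve: "smooth_projective_curve C" and jac: "jacobian_uniformization C \<pi>"
    and D: "principal_divisor C D" and E: "principal_divisor C E"
  shows "principal_divisor C (D + E)"
proof -
  have "\<pi> 0 \<in> Jac C 0"
    using jac by (auto simp: jacobian_uniformization_def)
  then obtain D0 where D0: "divisor_on C D0" "\<pi> 0 = div_class C D0"
    by (auto simp: Jac_def)
  have "cls_add (\<pi> 0) (\<pi> 0) = \<pi> 0"
    using jac unfolding jacobian_uniformization_def by (metis add.right_neutral)
  then have sub: "principal_divisor C (D0 + F + G)"
    if "principal_divisor C F" "principal_divisor C G" for F G
  proof -
    have "D0 + F + (D0 + G) \<in> \<pi> 0"
      using that \<open>cls_add (\<pi> 0) (\<pi> 0) = \<pi> 0\<close>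
      unfolding D0 div_class_eq[OF D0(1)] cls_add_def by blast
    then show ?thesis
      by (auto simp: D0 div_class_def algebra_simps)
  qed
  \<comment> \<open>The stray \<open>D0\<close> cancels: \<open>D0 - D\<close> is principal, hence
    so is its negative \<open>D - D0\<close>, and with this as first argument \<open>sub\<close>
    yields D0 + (D - D0) + E.\<close>
  have "principal_divisor C (D0 + - D + 0)"
    by (intro sub principal_divisor_uminus principal_divisor_0 curve D)
  from principal_divisor_uminus[OF this] have "principal_divisor C (D - D0)"
    by simp
  from sub[OF this E] show ?thesis by simp
qed

section \<open>Linear algebra\<close>

text \<open>Bilinear rather than Hermitian, so that exponents built from it are holomorphic in both
  arguments.\<close>

definition cdot :: "complex^'g \<Rightarrow> complex^'g \<Rightarrow> complex" where
  "cdot x y = (\<Sum>i\<in>UNIV. x $ i * y $ i)"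

definition cvec :: "real^'g \<Rightarrow> complex^'g" where
  "cvec a = (\<chi> i. of_real (a $ i))"

lemma cdot_commute: "cdot x y = cdot y x"
  by (simp add: cdot_def mult.commute)

lemma cdot_simps [simp]:
  "cdot (x + y) z = cdot x z + cdot y z" "cdot z (x + y) = cdot z x + cdot z y"
  "cdot (x - y) z = cdot x z - cdot y z" "cdot z (x - y) = cdot z x - cdot z y"
  "cdot (- x) z = - cdot x z" "cdot z (- x) = - cdot z x"
  "cdot 0 z = 0" "cdot z 0 = 0"
  "cdot (c *s x) z = c * cdot x z" "cdot z (c *s x) = c * cdot z x"
  by (simp_all add: cdot_def algebra_simps sum.distrib sum_subtractf sum_negf sum_distrib_left)

lemma cvec_simps [simp]:
  "cvec (a + b) = cvec a + cvec b" "cvec (a - b) = cvec a - cvec b" "cvec (- a) = - cvec a"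
  "cvec 0 = 0" "cvec (r *\<^sub>R a) = of_real r *s cvec a"
  by (simp_all add: cvec_def vec_eq_iff)

lemma cdot_cvec: "cdot (cvec a) (cvec b) = of_real (a \<bullet> b)"
  by (simp add: cdot_def cvec_def inner_vec_def)

lemma period_pt_eq: "period_pt \<tau> a b = \<tau> *v cvec a + cvec b"
  by (simp add: period_pt_def cvec_def matrix_vector_mult_def vec_eq_iff)

lemma matrix_vector_minus: "A *v (- x) = - (A *v (x :: complex^'g))"
  by (simp add: matrix_vector_mult_def vec_eq_iff sum_negf)

lemma period_pt_add: "period_pt \<tau> (a + c) (b + d) = period_pt \<tau> a b + period_pt \<tau> c d"
  by (simp add: period_pt_eq matrix_vector_right_distrib)

lemma period_pt_diff: "period_pt \<tau> (a - c) (b - d) = period_pt \<tau> a b - period_pt \<tau> c d"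
  by (simp add: period_pt_eq matrix_vector_mult_diff_distrib)

lemma period_pt_minus: "period_pt \<tau> (- a) (- b) = - period_pt \<tau> a b"
  by (simp add: period_pt_eq matrix_vector_minus)

lemma period_pt_0: "period_pt \<tau> 0 0 = 0"
  by (simp add: period_pt_eq)

lemma period_pt_scale: "period_pt \<tau> (r *\<^sub>R a) (r *\<^sub>R b) = r *\<^sub>R period_pt \<tau> a b"
  by (simp add: period_pt_def vec_eq_iff sum_distrib_left algebra_simps
      scaleR_conv_of_real[where 'a = complex])

lemma linear_period_pt_left: "linear (\<lambda>a. period_pt \<tau> a 0)"
  using period_pt_add[of \<tau> _ _ 0 0] period_pt_scale[of \<tau> _ _ 0] by (auto intro!: linearI)

lemma linear_period_pt_right: "linear (\<lambda>b. period_pt \<tau> 0 b)"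
  using period_pt_add[of \<tau> 0 0] period_pt_scale[of \<tau> _ 0] by (auto intro!: linearI)

section \<open>The Riemann form in period coordinates and the Riemann relations\<close>

lemma bilinear_eq_on_axis:
  fixes B B' :: "real^'g \<Rightarrow> real^'g \<Rightarrow> real"
  assumes "bilinear B" "bilinear B'" "\<And>i j. B (axis i 1) (axis j 1) = B' (axis i 1) (axis j 1)"
  shows "B x y = B' x y"
proof -
  have "B = B'"
    by (rule bilinear_eq_stdbasis[OF assms(1,2)]) (auto simp: Basis_vec_def assms(3))
  then show ?thesis by simp
qed

text \<open>The symplectic basis fixes \<open>E\<close> only on basis vectors, but \<open>E\<close>
  is real bilinear and (a, b) are real coordinates. Three of the four blocks are compared on axis
  vectors; the fourth follows from the mixed block because \<open>E\<close> is alternating.\<close>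

lemma symplectic_form_period_pt:
  fixes \<tau> :: "complex^'g^'g"
  assumes "bilinear E" "\<And>u. E u u = 0" "symplectic_period_matrix \<pi> E \<tau>"
  shows "E (period_pt \<tau> a b) (period_pt \<tau> c d) = a \<bullet> d - b \<bullet> c"
proof -
  have alt: "E u v = - E v u" for u v
    using assms(2)[of "u + v"] assms(2)[of u] assms(2)[of v]
    by (simp add: bilinear_ladd[OF assms(1)] bilinear_radd[OF assms(1)])
  have lin: "bilinear (\<lambda>x y. E (f x) (g y))"
    if "linear f" "linear g" for f g :: "real^'g \<Rightarrow> complex^'g"
    using that assms(1) unfolding bilinear_def by (auto intro: linear_compose[unfolded o_def])
  note l = linear_period_pt_left[of \<tau>] and r = linear_period_pt_right[of \<tau>]
  have inner: "bilinear (\<lambda>x y :: real^'g. x \<bullet> y)"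
    by (simp add: bilinear_conv_bounded_bilinear bounded_bilinear_inner)
  have zero: "bilinear (\<lambda>(x::real^'g) (y::real^'g). 0::real)"
    by (auto simp: bilinear_def linear_iff)
  have ax: "axis i 1 \<bullet> (axis j 1 :: real^'g) = (if i = j then 1 else 0)" for i j
    by (simp add: inner_axis_axis)
  have "E (period_pt \<tau> a 0) (period_pt \<tau> c 0) = 0"
    by (rule bilinear_eq_on_axis[OF lin[OF l l] zero])
      (use assms(3) in \<open>auto simp: symplectic_period_matrix_def\<close>)
  moreover have "E (period_pt \<tau> 0 b) (period_pt \<tau> 0 d) = 0"
    by (rule bilinear_eq_on_axis[OF lin[OF r r] zero])
      (use assms(3) in \<open>auto simp: symplectic_period_matrix_def\<close>)
  moreover have mix: "E (period_pt \<tau> x 0) (period_pt \<tau> 0 y) = x \<bullet> y" for x y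
    by (rule bilinear_eq_on_axis[OF lin[OF l r] inner])
      (use assms(3) ax in \<open>auto simp: symplectic_period_matrix_def\<close>)
  moreover have "E (period_pt \<tau> 0 b) (period_pt \<tau> c 0) = - (b \<bullet> c)"
    using alt[of "period_pt \<tau> 0 b" "period_pt \<tau> c 0"] mix[of c b] by (simp add: inner_commute)
  moreover have "period_pt \<tau> a b = period_pt \<tau> a 0 + period_pt \<tau> 0 b"
    "period_pt \<tau> c d = period_pt \<tau> c 0 + period_pt \<tau> 0 d"
    using period_pt_add[of \<tau> a 0 0 b] period_pt_add[of \<tau> c 0 0 d] by simp_all
  ultimately show ?thesis
    by (simp add: bilinear_ladd[OF assms(1)] bilinear_radd[OF assms(1)])
qed

text \<open>For real \<open>x\<close> the vector \<open>i Im(\<tau>) x\<close> equals \<open>\<tau>x - Re(\<tau>) x\<close>, so that the Riemann relations can be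
  read off from the values of \<open>E\<close> on such vectors.\<close>

definition Re_mat :: "complex^'g^'g \<Rightarrow> real^'g^'g" where
  "Re_mat \<tau> = (\<chi> i j. Re (\<tau> $ i $ j))"

definition Im_mat :: "complex^'g^'g \<Rightarrow> real^'g^'g" where
  "Im_mat \<tau> = (\<chi> i j. Im (\<tau> $ i $ j))"

lemma i_Im_mat: "\<i> *s period_pt \<tau> 0 (Im_mat \<tau> *v x) = period_pt \<tau> x (- (Re_mat \<tau> *v x))"
  by (simp add: period_pt_def vec_eq_iff Re_mat_def Im_mat_def matrix_vector_mult_def
      complex_eq_iff)

text \<open>Real independence of the periods follows from non-degeneracy: pairing (a, b) with (-b,
  a) under \<open>E\<close> gives |a|^2 + |b|^2.\<close>

lemma period_pt_eq_0_iff: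
  assumes "bilinear E" "\<And>u. E u u = 0" "symplectic_period_matrix \<pi> E \<tau>"
  shows "period_pt \<tau> a b = 0 \<longleftrightarrow> a = 0 \<and> b = 0"
proof
  assume "period_pt \<tau> a b = 0"
  then have "E (period_pt \<tau> a b) (period_pt \<tau> (-b) a) = 0"
    by (simp add: bilinear_lzero[OF assms(1)])
  then have "a \<bullet> a + b \<bullet> b = 0"
    by (simp add: symplectic_form_period_pt[OF assms])
  then show "a = 0 \<and> b = 0"
    by (metis add_nonneg_eq_0_iff inner_eq_zero_iff inner_ge_zero)
qed (simp add: period_pt_0)

text \<open>Let u(x) = Im(\<tau>) x, so that i u(x) has period coordinates (x, - Re(\<tau>) x). Then
  E(i u(x), u(y)) = x . Im(\<tau>) y, while E(i u(x), i u(y)) = E(u(x), u(y)) = 0 says that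
  Re(\<tau>) is symmetric. Invariance under i and alternation make E(iu, v) symmetric, hence
  Im(\<tau>) symmetric, and positivity of the polarization is positivity of Im(\<tau>).\<close>

lemma riemann_relations:
  assumes E: "bilinear E" "\<And>u. E u u = 0" "symplectic_period_matrix \<pi> E \<tau>"
    and J: "\<And>u v. E (\<i> *s u) (\<i> *s v) = E u v"
    and pos: "\<And>u. u \<noteq> 0 \<Longrightarrow> E (\<i> *s u) u > 0"
  shows "transpose \<tau> = \<tau>"
    and "x \<noteq> 0 \<Longrightarrow> x \<bullet> (Im_mat \<tau> *v x) > 0"
proof -
  note e = symplectic_form_period_pt[OF E]
  let ?X = "\<lambda>x. Re_mat \<tau> *v x" and ?Y = "\<lambda>x. Im_mat \<tau> *v x"
  have nz: "period_pt \<tau> 0 (?Y x) \<noteq> 0" if "x \<noteq> 0" for x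
  proof
    assume "period_pt \<tau> 0 (?Y x) = 0"
    then have "period_pt \<tau> x (- ?X x) = 0"
      by (simp flip: i_Im_mat)
    then show False
      using that by (simp add: period_pt_eq_0_iff[OF E])
  qed
  show "x \<bullet> ?Y x > 0" if "x \<noteq> 0"
    using pos[OF nz[OF that]] by (simp add: i_Im_mat e)
  have X: "x \<bullet> ?X y = ?X x \<bullet> y" for x y
    using J[of "period_pt \<tau> 0 (?Y x)" "period_pt \<tau> 0 (?Y y)"] by (simp add: i_Im_mat e)
  have ineg: "\<i> *s (\<i> *s u) = - u" for u :: "complex^'a"
    by (simp add: vec_eq_iff)
  have alt: "E u v = - E v u" for u v
    using E(2)[of "u + v"] E(2)[of u] E(2)[of v]
    by (simp add: bilinear_ladd[OF E(1)] bilinear_radd[OF E(1)])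
  have sym: "E (\<i> *s u) v = E (\<i> *s v) u" for u v
    using J[of "\<i> *s u" v] alt[of u "\<i> *s v"] by (simp add: ineg bilinear_lneg[OF E(1)])
  have Y: "x \<bullet> ?Y y = y \<bullet> ?Y x" for x y
    using sym[of "period_pt \<tau> 0 (?Y x)" "period_pt \<tau> 0 (?Y y)"] by (simp add: i_Im_mat e)
  have entry: "axis i 1 \<bullet> (M *v axis j 1) = M $ i $ j" for M :: "real^'a^'a" and i j
    by (simp add: matrix_vector_mult_basis inner_axis' column_def)
  have "Re (\<tau> $ j $ i) = Re (\<tau> $ i $ j)" "Im (\<tau> $ j $ i) = Im (\<tau> $ i $ j)" for i j
    using X[of "axis i 1" "axis j 1"] Y[of "axis i 1" "axis j 1"]
      entry[of i "Re_mat \<tau>" j] entry[of j "Re_mat \<tau>" i] entry[of i "Im_mat \<tau>" j] entry[of j "Im_mat \<tau>" i]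
    by (simp_all add: inner_commute Re_mat_def Im_mat_def)
  then show "transpose \<tau> = \<tau>"
    by (simp add: transpose_def vec_eq_iff complex_eq_iff)
qed

section \<open>Holomorphic functions of several variables\<close>

lemma holo_on_subset: "holo_on f U \<Longrightarrow> V \<subseteq> U \<Longrightarrow> holo_on f V"
  by (auto simp: holo_on_def)

lemma holo_on_imp_continuous_on: "holo_on f U \<Longrightarrow> continuous_on U f"
  by (meson continuous_at_imp_continuous_on has_derivative_continuous holo_on_def)

lemma holo_on_const [simp]: "holo_on (\<lambda>z. c) U"
  unfolding holo_on_def by (auto intro!: exI[of _ "\<lambda>v. 0"])

lemma holo_on_add:
  assumes "holo_on f U" "holo_on g U"
  shows "holo_on (\<lambda>z. f z + g z) U"
  unfolding holo_on_def
proof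
  fix z assume "z \<in> U"
  then obtain L M where "(f has_derivative L) (at z)" "(g has_derivative M) (at z)"
    "\<forall>c v. L (c *s v) = c * L v" "\<forall>c v. M (c *s v) = c * M v"
    using assms unfolding holo_on_def by meson
  then show "\<exists>L. ((\<lambda>z. f z + g z) has_derivative L) (at z) \<and> (\<forall>c v. L (c *s v) = c * L v)"
    by (intro exI[of _ "\<lambda>v. L v + M v"]) (auto intro: has_derivative_add simp: algebra_simps)
qed

lemma holo_on_mult:
  assumes "holo_on f U" "holo_on g U"
  shows "holo_on (\<lambda>z. f z * g z) U"
  unfolding holo_on_def
proof
  fix z assume "z \<in> U"
  then obtain L M where "(f has_derivative L) (at z)" "(g has_derivative M) (at z)"
    "\<forall>c v. L (c *s v) = c * L v" "\<forall>c v. M (c *s v) = c * M v"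
    using assms unfolding holo_on_def by meson
  then show "\<exists>L. ((\<lambda>z. f z * g z) has_derivative L) (at z) \<and> (\<forall>c v. L (c *s v) = c * L v)"
    using has_derivative_mult[of f L z UNIV g M]
    by (intro exI[of _ "\<lambda>v. f z * M v + L v * g z"] conjI) (simp, simp add: algebra_simps)
qed

lemma holo_on_power:
  assumes "holo_on f U"
  shows "holo_on (\<lambda>z. f z ^ n) U"
  by (induction n) (auto intro: holo_on_mult assms)

lemma holo_on_exp:
  assumes "holo_on f U"
  shows "holo_on (\<lambda>z. exp (f z)) U"
  unfolding holo_on_def
proof
  fix z assume "z \<in> U"
  then obtain L where L: "(f has_derivative L) (at z)" "\<forall>c v. L (c *s v) = c * L v"
    using assms unfolding holo_on_def by meson
  have "(exp has_derivative (*) (exp (f z))) (at (f z))"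
    using DERIV_exp[of "f z"] by (simp add: has_field_derivative_def)
  from has_derivative_compose[OF L(1) this] L(2)
  show "\<exists>L. ((\<lambda>z. exp (f z)) has_derivative L) (at z) \<and> (\<forall>c v. L (c *s v) = c * L v)"
    by (intro exI[of _ "\<lambda>v. exp (f z) * L v"]) auto
qed

lemma holo_on_translate:
  assumes "holo_on f U"
  shows "holo_on (\<lambda>z. f (z - p)) {z. z - p \<in> U}"
  unfolding holo_on_def
proof
  fix z assume "z \<in> {z. z - p \<in> U}"
  then obtain L where L: "(f has_derivative L) (at (z - p))" "\<forall>c v. L (c *s v) = c * L v"
    using assms unfolding holo_on_def by blast
  have "((\<lambda>z. z - p) has_derivative (\<lambda>v. v)) (at z)"
    by (auto intro!: derivative_eq_intros)
  from has_derivative_compose[OF this L(1)] L(2)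
  show "\<exists>L. ((\<lambda>z. f (z - p)) has_derivative L) (at z) \<and> (\<forall>c v. L (c *s v) = c * L v)"
    by auto
qed

lemma holo_on_cdot: "holo_on (cdot c) U"
proof -
  have "linear (cdot c)"
  proof (rule linearI)
    show "cdot c (r *\<^sub>R x) = r *\<^sub>R cdot c x" for r x
      by (simp add: cdot_def scaleR_right.sum)
  qed simp
  then have "bounded_linear (cdot c)"
    by (simp add: linear_conv_bounded_linear)
  then show ?thesis
    unfolding holo_on_def by (auto intro!: exI[of _ "cdot c"] bounded_linear_imp_has_derivative)
qed

lemma holo_on_line:
  assumes "holo_on f UNIV"
  shows "(\<lambda>t. f (w + t *s v)) holomorphic_on S"
proof (rule holomorphic_onI)
  fix t
  obtain L where L: "(f has_derivative L) (at (w + t *s v))" "\<forall>c v. L (c *s v) = c * L v"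
    using assms unfolding holo_on_def by blast
  have "linear (\<lambda>t. t *s v)"
    by (rule linearI) (simp_all add: vec_eq_iff algebra_simps scaleR_conv_of_real[where 'a = complex])
  then have "((\<lambda>t. t *s v) has_derivative (\<lambda>t. t *s v)) (at t)"
    by (intro bounded_linear_imp_has_derivative) (simp add: linear_conv_bounded_linear)
  then have "((\<lambda>t. w + t *s v) has_derivative (\<lambda>t. t *s v)) (at t)"
    by (auto intro!: derivative_eq_intros)
  from has_derivative_compose[OF this L(1)]
  have "((\<lambda>t. f (w + t *s v)) has_derivative (*) (L v)) (at t)"
    using L(2) by (simp add: mult.commute[of _ "L v"])
  then show "(\<lambda>t. f (w + t *s v)) field_differentiable at t within S"
    by (meson field_differentiable_at_within field_differentiable_def has_field_derivative_def)
qed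

text \<open>On the complex line through \<open>w\<close> and \<open>z0\<close> the function is
  entire in one variable. If it vanished near \<open>w\<close>, the identity theorem would make it
  vanish at \<open>z0\<close>, the point with parameter 1.\<close>

lemma entire_nonzero_dense:
  assumes f: "holo_on f UNIV" "f z0 \<noteq> 0" and V: "open V" "w \<in> V"
  shows "\<exists>x\<in>V. f x \<noteq> 0"
proof (rule ccontr)
  assume "\<not> ?thesis"
  then have 0: "f x = 0" if "x \<in> V" for x using that by blast
  let ?l = "\<lambda>t. w + t *s (z0 - w)"
  have "?l = (\<lambda>t. \<chi> i. w $ i + t * (z0 - w) $ i)"
    by (simp add: fun_eq_iff vec_eq_iff algebra_simps)
  then have "continuous_on UNIV ?l"
    by (simp only:) (intro continuous_intros)
  then have "open (?l -` V)"
    using V(1) by (simp add: open_vimage)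
  moreover have "0 \<in> ?l -` V"
    using V by (simp add: vec_eq_iff)
  moreover from this have "?l -` V \<noteq> {}"
    by blast
  ultimately have "f (?l 1) = 0"
    by (intro analytic_continuation_open[of "?l -` V" UNIV "\<lambda>t. f (?l t)" "\<lambda>t. 0" 1])
      (auto intro: holo_on_line[OF f(1)] 0 simp del: vector_ssub_ldistrib)
  then show False
    using f(2) by simp
qed

text \<open>The set where two continuous functions differ is open, so if it were non-empty it would
  meet the dense set where \<open>k\<close> is non-zero.\<close>

lemma eq_by_density:
  fixes f g :: "complex^'g \<Rightarrow> complex"
  assumes k: "holo_on k UNIV" "k z0 \<noteq> 0"
    and U: "open U" "z \<in> U" "continuous_on U f" "continuous_on U g"
    and eq: "\<And>w. w \<in> U \<Longrightarrow> k w \<noteq> 0 \<Longrightarrow> f w = g w"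
  shows "f z = g z"
proof (rule ccontr)
  assume "f z \<noteq> g z"
  define V where "V = U \<inter> (\<lambda>w. f w - g w) -` (- {0})"
  have "open V"
    unfolding V_def using U
    by (intro continuous_open_preimage continuous_on_diff) auto
  moreover have "z \<in> V"
    using U \<open>f z \<noteq> g z\<close> by (simp add: V_def)
  ultimately obtain x where "x \<in> V" "k x \<noteq> 0"
    using entire_nonzero_dense[OF k] by blast
  then show False
    using eq[of x] by (simp add: V_def)
qed

lemma reduced_equation_translate:
  assumes h: "reduced_equation S UNIV h"
  shows "reduced_equation {z. z - p \<in> S} UNIV (\<lambda>z. h (z - p))"
  unfolding reduced_equation_def
proof (intro conjI allI impI)
  show "holo_on (\<lambda>z. h (z - p)) UNIV"
    using holo_on_translate[of h UNIV p] h by (simp add: reduced_equation_def)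
  show "\<forall>w\<in>UNIV. (h (w - p) = 0) = (w \<in> {z. z - p \<in> S})"
    using h by (simp add: reduced_equation_def)
  fix V k w
  assume *: "open V \<and> V \<subseteq> UNIV \<and> w \<in> V \<and> holo_on k V \<and> (\<forall>x\<in>V \<inter> {z. z - p \<in> S}. k x = 0)"
  \<comment> \<open>The test function is moved back by \<open>p\<close>, divided there, and its
    quotient moved forward again. Writing \<open>- (- p)\<close> for the backward shift lets
    \<open>holo_on_translate\<close> serve both directions.\<close>
  define V' where "V' = {z. z - (- p) \<in> V}"
  have op: "open {z. z - q \<in> A}" if "open A" for A and q :: "complex^'a"
    using open_vimage[OF that, of "\<lambda>z. z - q"] by (simp add: vimage_def continuous_on_diff)
  have "open V'" "w - p \<in> V'" "holo_on (\<lambda>z. k (z - (- p))) V'"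
    using * holo_on_translate[of k V "- p"] op[of V "- p"] by (simp_all add: V'_def)
  moreover have "\<forall>x\<in>V' \<inter> S. k (x - (- p)) = 0"
    using * by (simp add: V'_def)
  ultimately obtain W q where W: "open W" "w - p \<in> W" "W \<subseteq> V'" "holo_on q W"
    "\<forall>x\<in>W. k (x - (- p)) = q x * h x"
    using h[unfolded reduced_equation_def, THEN conjunct2, THEN conjunct2, THEN conjunct2,
      rule_format, of V' "w - p" "\<lambda>z. k (z - (- p))"] by blast
  show "\<exists>W q. open W \<and> w \<in> W \<and> W \<subseteq> V \<and> holo_on q W \<and> (\<forall>x\<in>W. k x = q x * h (x - p))"
  proof (intro exI conjI ballI)
    show "open {z. z - p \<in> W}" "w \<in> {z. z - p \<in> W}" "holo_on (\<lambda>z. q (z - p)) {z. z - p \<in> W}"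
      using W op[of W p] holo_on_translate[OF W(4), of p] by simp_all
    show "{z. z - p \<in> W} \<subseteq> V"
    proof
      fix x assume "x \<in> {z. z - p \<in> W}"
      then have "x - p - (- p) \<in> V" using W(3) unfolding V'_def by blast
      then show "x \<in> V" by simp
    qed
    show "k x = q (x - p) * h (x - p)" if "x \<in> {z. z - p \<in> W}" for x
      using W(5)[rule_format, of "x - p"] that by simp
  qed
qed simp

section \<open>Quotients of entire functions, extended to all their regular points\<close>

definition extends_to ::
  "(complex^'g \<Rightarrow> complex) \<Rightarrow> (complex^'g \<Rightarrow> complex) \<Rightarrow> complex^'g \<Rightarrow> complex \<Rightarrow> bool" where
  "extends_to u k z c \<longleftrightarrow> (\<exists>U h. open U \<and> z \<in> U \<and> holo_on h U \<and>
     (\<forall>w\<in>U. k w \<noteq> 0 \<longrightarrow> h w = u w / k w) \<and> h z = c)"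

text \<open>Defined wherever some holomorphic germ continues the quotient, including common zeros of
  \<open>u\<close> and \<open>k\<close> at which the singularity is removable. This maximality is
  what the second clause of \<open>meromorphic_map\<close> demands.\<close>

definition holo_quotient ::
  "(complex^'g \<Rightarrow> complex) \<Rightarrow> (complex^'g \<Rightarrow> complex) \<Rightarrow> complex^'g \<Rightarrow> complex option" where
  "holo_quotient u k z =
     (if \<exists>c. extends_to u k z c then Some (SOME c. extends_to u k z c) else None)"

lemma holo_on_divide:
  assumes "holo_on u U" "holo_on k U" "\<And>z. z \<in> U \<Longrightarrow> k z \<noteq> 0"
  shows "holo_on (\<lambda>z. u z / k z) U"
  unfolding holo_on_def
proof
  fix z assume z: "z \<in> U"
  then obtain L M where L: "(u has_derivative L) (at z)" "(k has_derivative M) (at z)"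
    "\<forall>c v. L (c *s v) = c * L v" "\<forall>c v. M (c *s v) = c * M v"
    using assms unfolding holo_on_def by meson
  show "\<exists>L. ((\<lambda>z. u z / k z) has_derivative L) (at z) \<and> (\<forall>c v. L (c *s v) = c * L v)"
    by (intro exI conjI, rule has_derivative_divide'[OF L(1,2) assms(3)[OF z]])
      (simp add: L(3,4) algebra_simps diff_divide_distrib)
qed

context
  fixes u k :: "complex^'g \<Rightarrow> complex" and z0
  assumes u: "holo_on u UNIV" and k: "holo_on k UNIV" "k z0 \<noteq> 0"
begin

lemma extends_to_unique:
  assumes "extends_to u k z c" "extends_to u k z d"
  shows "c = d"
proof -
  obtain U h where U: "open U" "z \<in> U" "holo_on h U"
    "\<forall>w\<in>U. k w \<noteq> 0 \<longrightarrow> h w = u w / k w" "h z = c"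
    using assms(1) by (auto simp: extends_to_def)
  obtain V g where V: "open V" "z \<in> V" "holo_on g V"
    "\<forall>w\<in>V. k w \<noteq> 0 \<longrightarrow> g w = u w / k w" "g z = d"
    using assms(2) by (auto simp: extends_to_def)
  have "h z = g z"
    by (rule eq_by_density[OF k, of "U \<inter> V"])
      (use U V in \<open>auto intro: holo_on_imp_continuous_on holo_on_subset\<close>)
  then show ?thesis
    using U V by simp
qed

lemma holo_quotient_eq_Some_iff: "holo_quotient u k z = Some c \<longleftrightarrow> extends_to u k z c"
  unfolding holo_quotient_def using extends_to_unique
  by (auto intro: someI some_equality)

lemma holo_quotient_nonzero:
  assumes "k z \<noteq> 0"
  shows "holo_quotient u k z = Some (u z / k z)"
proof -
  have "open {w. k w \<noteq> 0}"
    using open_vimage[OF open_Compl[OF closed_singleton] holo_on_imp_continuous_on[OF k(1)], of 0]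
    by (simp add: vimage_def)
  then show ?thesis
    unfolding holo_quotient_eq_Some_iff extends_to_def using assms u k
    by (intro exI[of _ "{w. k w \<noteq> 0}"] exI[of _ "\<lambda>z. u z / k z"])
      (auto intro!: holo_on_divide intro: holo_on_subset)
qed

text \<open>A germ that witnesses a value at \<open>z\<close> witnesses its own values at all points
  of its neighbourhood. Conversely, a germ compatible with the partial function must equal u/k
  wherever \<open>k\<close> is non-zero, because there the partial function is never
  \<open>None\<close>.\<close>

lemma meromorphic_map_holo_quotient: "meromorphic_map (holo_quotient u k)"
  unfolding meromorphic_map_def
proof (intro conjI allI)
  fix z
  show "\<exists>U h k'. open U \<and> z \<in> U \<and> holo_on h U \<and> holo_on k' U \<and>
      (\<forall>V. open V \<and> V \<noteq> {} \<and> V \<subseteq> U \<longrightarrow> (\<exists>w\<in>V. k' w \<noteq> 0)) \<and>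
      (\<forall>w\<in>U. k' w \<noteq> 0 \<longrightarrow> holo_quotient u k w = Some (h w / k' w))"
  proof (intro exI conjI allI impI ballI)
    show "\<exists>w\<in>V. k w \<noteq> 0" if "open V \<and> V \<noteq> {} \<and> V \<subseteq> UNIV" for V
      using that entire_nonzero_dense[OF k, of V] by blast
    show "holo_quotient u k w = Some (u w / k w)" if "k w \<noteq> 0" for w
      by (rule holo_quotient_nonzero[OF that])
  qed (use u k in simp_all)
next
  fix z c
  show "holo_quotient u k z = Some c \<longleftrightarrow>
    (\<exists>U h. open U \<and> z \<in> U \<and> holo_on h U \<and> h z = c \<and>
       (\<forall>w\<in>U. holo_quotient u k w \<in> {None, Some (h w)}))" (is "?L \<longleftrightarrow> ?R")
  proof
    assume ?L
    then obtain U h where U: "open U" "z \<in> U" "holo_on h U"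
      "\<forall>w\<in>U. k w \<noteq> 0 \<longrightarrow> h w = u w / k w" "h z = c"
      by (auto simp: holo_quotient_eq_Some_iff extends_to_def)
    have "holo_quotient u k w \<in> {None, Some (h w)}" if "w \<in> U" for w
    proof -
      have "extends_to u k w (h w)"
        unfolding extends_to_def using U that by blast
      then show ?thesis
        by (simp flip: holo_quotient_eq_Some_iff)
    qed
    then show ?R using U by blast
  next
    assume ?R
    then obtain U h where U: "open U" "z \<in> U" "holo_on h U" "h z = c"
      "\<forall>w\<in>U. holo_quotient u k w \<in> {None, Some (h w)}" by blast
    then have "\<forall>w\<in>U. k w \<noteq> 0 \<longrightarrow> h w = u w / k w"
      using holo_quotient_nonzero by force
    then show ?L
      unfolding holo_quotient_eq_Some_iff extends_to_def using U by blast
  qed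
qed

end

section \<open>The theta function\<close>

definition int_vec :: "int^'g \<Rightarrow> real^'g" where
  "int_vec n = (\<chi> i. of_int (n $ i))"

abbreviation int_coord :: "real^'g \<Rightarrow> bool" where
  "int_coord a \<equiv> \<forall>i. a $ i \<in> \<int>"

lemma int_vec_add [simp]: "int_vec (m + n) = int_vec m + int_vec n"
  by (simp add: int_vec_def vec_eq_iff)

lemma int_vec_exists:
  assumes "int_coord a"
  shows "\<exists>n. a = int_vec n"
proof -
  have "\<forall>i. \<exists>k. a $ i = of_int k" using assms by (auto elim: Ints_cases)
  then obtain k where "\<forall>i. a $ i = of_int (k i)" by metis
  then show ?thesis
    by (intro exI[of _ "\<chi> i. k i"]) (simp add: int_vec_def vec_eq_iff)
qed

lemma inner_Ints:
  assumes "int_coord a" "int_coord b"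
  shows "a \<bullet> b \<in> \<int>"
  using assms by (auto simp: inner_vec_def intro!: Ints_sum Ints_mult)

lemma exp_2pi_eq_1_iff: "exp (2 * of_real pi * \<i> * of_real r) = 1 \<longleftrightarrow> r \<in> \<int>"
proof -
  have "2 * pi * r = of_int (2 * n) * pi \<longleftrightarrow> r = of_int n" for n
    by simp
  then show ?thesis
    by (simp add: exp_eq_1 Ints_def image_iff del: of_int_mult)
qed

lemma cdot_matrix_commute:
  assumes "transpose \<tau> = \<tau>"
  shows "cdot x (\<tau> *v y) = cdot y (\<tau> *v x)"
proof -
  have sym: "\<tau> $ i $ j = \<tau> $ j $ i" for i j
    using arg_cong[OF assms, of "\<lambda>A. A $ j $ i"] by (simp add: transpose_def)
  have "cdot x (\<tau> *v y) = (\<Sum>i\<in>UNIV. \<Sum>j\<in>UNIV. x $ i * (\<tau> $ i $ j * y $ j))"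
    by (simp add: cdot_def matrix_vector_mult_def sum_distrib_left)
  also have "\<dots> = (\<Sum>j\<in>UNIV. \<Sum>i\<in>UNIV. x $ i * (\<tau> $ i $ j * y $ j))"
    by (rule sum.swap)
  also have "\<dots> = (\<Sum>j\<in>UNIV. \<Sum>i\<in>UNIV. y $ j * (\<tau> $ j $ i * x $ i))"
    by (intro sum.cong refl, subst sym) (simp add: mult_ac)
  also have "\<dots> = cdot y (\<tau> *v x)"
    by (simp add: cdot_def matrix_vector_mult_def sum_distrib_left)
  finally show ?thesis .
qed

section \<open>Characteristics, translations and quasi-periodicity\<close>

lemma theta_char_cdot:
  "theta_char a b z \<tau> = (\<Sum>\<^sub>\<infinity>n\<in>UNIV. exp (of_real pi * \<i> *
     (2 * cdot (cvec (int_vec n + a)) (z + cvec b) +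
      cdot (cvec (int_vec n + a)) (\<tau> *v cvec (int_vec n + a)))))"
  by (simp add: theta_char_def cdot_def cvec_def int_vec_def matrix_vector_mult_def
      sum_distrib_left mult.assoc)

text \<open>The identity holds term by term: when the quadratic form is expanded at n + a + c,
  symmetry of \<tau> merges the two cross terms into 2 (n + a) . \<tau>c, which is the effect of
  translating z by \<tau>c. What depends on c but not on n is the factor in front.\<close>

lemma theta_char_add:
  assumes "transpose \<tau> = \<tau>"
  shows "theta_char (a + c) (b + d) z \<tau> =
    exp (of_real pi * \<i> * (2 * cdot (cvec c) (z + cvec b + cvec d) + cdot (cvec c) (\<tau> *v cvec c))) *
    theta_char a b (z + period_pt \<tau> c d) \<tau>"
  unfolding theta_char_cdot infsum_cmult_right'[symmetric] exp_add[symmetric]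
proof (rule infsum_cong, rule arg_cong[where f = exp])
  fix n
  define x where "x = cvec (int_vec n + a)"
  have x: "cvec (int_vec n + (a + c)) = x + cvec c"
    by (simp add: x_def)
  have "2 * cdot (x + cvec c) (z + cvec (b + d)) + cdot (x + cvec c) (\<tau> *v (x + cvec c)) =
    (2 * cdot (cvec c) (z + cvec b + cvec d) + cdot (cvec c) (\<tau> *v cvec c)) +
    (2 * cdot x (z + period_pt \<tau> c d + cvec b) + cdot x (\<tau> *v x))"
    using cdot_matrix_commute[OF assms, of "cvec c" x]
    by (simp add: period_pt_eq matrix_vector_right_distrib algebra_simps)
  then show "of_real pi * \<i> * (2 * cdot (cvec (int_vec n + (a + c))) (z + cvec (b + d)) +
      cdot (cvec (int_vec n + (a + c))) (\<tau> *v cvec (int_vec n + (a + c)))) =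
    of_real pi * \<i> * (2 * cdot (cvec c) (z + cvec b + cvec d) + cdot (cvec c) (\<tau> *v cvec c)) +
    of_real pi * \<i> * (2 * cdot (cvec (int_vec n + a)) (z + period_pt \<tau> c d + cvec b) +
      cdot (cvec (int_vec n + a)) (\<tau> *v cvec (int_vec n + a)))"
    by (simp only: x x_def[symmetric] distrib_left)
qed

lemma theta_char_eq_theta:
  assumes "transpose \<tau> = \<tau>"
  shows "theta_char a b z \<tau> =
    exp (of_real pi * \<i> * (2 * cdot (cvec a) (z + cvec b) + cdot (cvec a) (\<tau> *v cvec a))) *
    theta_char 0 0 (z + period_pt \<tau> a b) \<tau>"
  using theta_char_add[OF assms, of 0 a 0 b z] by simp

text \<open>An integral \<open>a\<close> is absorbed by a shift of the summation index; an integral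
  \<open>b\<close> then changes each exponent by 2 pi i times an integer.\<close>

lemma theta_char_Ints:
  assumes "int_coord a" "int_coord b"
  shows "theta_char a b z \<tau> = theta_char 0 0 z \<tau>"
proof -
  obtain m where m: "a = int_vec m" using int_vec_exists[OF assms(1)] by blast
  define F where "F n = exp (of_real pi * \<i> *
    (2 * cdot (cvec (int_vec n)) z + cdot (cvec (int_vec n)) (\<tau> *v cvec (int_vec n))))" for n
  have "exp (of_real pi * \<i> * (2 * cdot (cvec (int_vec n + a)) (z + cvec b) +
      cdot (cvec (int_vec n + a)) (\<tau> *v cvec (int_vec n + a)))) = F (n + m)" for n
  proof -
    have "(int_vec n + a) \<bullet> b \<in> \<int>"
      using assms by (intro inner_Ints) (auto simp: int_vec_def)
    then have "exp (2 * of_real pi * \<i> * cdot (cvec (int_vec n + a)) (cvec b)) = 1"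
      unfolding cdot_cvec by (simp add: exp_2pi_eq_1_iff)
    then show ?thesis
      by (simp add: F_def m ring_distribs mult_ac flip: exp_add)
        (simp add: exp_add ring_distribs mult_ac)
  qed
  then have "theta_char a b z \<tau> = (\<Sum>\<^sub>\<infinity>n\<in>UNIV. F (n + m))"
    by (simp only: theta_char_cdot)
  also have "\<dots> = infsum F UNIV"
    by (rule infsum_reindex_bij_betw) (rule bij_plus_right)
  also have "\<dots> = theta_char 0 0 z \<tau>"
    by (simp add: theta_char_cdot F_def[abs_def])
  finally show ?thesis .
qed

text \<open>Theta with integral characteristics is computed twice: it equals \<theta> itself, and it
  equals an exponential times \<theta> translated by the period.\<close>

lemma theta_quasi_periodic:
  fixes a b :: "real^'g"
  assumes "transpose \<tau> = \<tau>" "int_coord a" "int_coord b"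
  shows "theta_char 0 0 (z + period_pt \<tau> a b) \<tau> =
    exp (- (of_real pi * \<i> * (2 * cdot (cvec a) z + cdot (cvec a) (\<tau> *v cvec a)))) *
    theta_char 0 0 z \<tau>"
proof -
  have "exp (2 * of_real pi * \<i> * cdot (cvec a) (cvec b)) = 1"
    unfolding cdot_cvec by (simp only: exp_2pi_eq_1_iff) (intro inner_Ints assms)
  moreover have "of_real pi * \<i> * (2 * cdot (cvec a) (z + cvec b) + cdot (cvec a) (\<tau> *v cvec a)) =
    of_real pi * \<i> * (2 * cdot (cvec a) z + cdot (cvec a) (\<tau> *v cvec a)) +
    2 * of_real pi * \<i> * cdot (cvec a) (cvec b)"
    by (simp add: algebra_simps)
  ultimately have "theta_char 0 0 z \<tau> =
    exp (of_real pi * \<i> * (2 * cdot (cvec a) z + cdot (cvec a) (\<tau> *v cvec a))) *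
    theta_char 0 0 (z + period_pt \<tau> a b) \<tau>"
    using theta_char_eq_theta[OF assms(1), of a b z] theta_char_Ints[OF assms(2,3), of z \<tau>]
    by (simp add: exp_add)
  then show ?thesis
    by (simp add: exp_minus)
qed

section \<open>Absolute convergence of the theta series\<close>

lemma pos_def_bound:
  fixes A :: "real^'g^'g"
  assumes "\<And>x. x \<noteq> 0 \<Longrightarrow> x \<bullet> (A *v x) > 0"
  obtains c where "c > 0" "\<And>x. x \<bullet> (A *v x) \<ge> c * (norm x)\<^sup>2"
proof -
  have cont: "continuous_on (sphere (0::real^'g) 1) (\<lambda>x. x \<bullet> (A *v x))"
    by (intro continuous_on_inner continuous_on_id matrix_vector_mult_linear_continuous_on)
  have "axis undefined 1 \<in> sphere (0::real^'g) 1"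
    by simp
  then have "sphere (0::real^'g) 1 \<noteq> {}"
    by blast
  then obtain u where u: "u \<in> sphere 0 1" "\<forall>x\<in>sphere 0 1. u \<bullet> (A *v u) \<le> x \<bullet> (A *v x)"
    using continuous_attains_inf[OF compact_sphere _ cont] by blast
  show thesis
  proof
    show "u \<bullet> (A *v u) > 0"
      using u(1) by (intro assms) auto
    show "x \<bullet> (A *v x) \<ge> u \<bullet> (A *v u) * (norm x)\<^sup>2" for x
    proof (cases "x = 0")
      case False
      let ?y = "inverse (norm x) *\<^sub>R x"
      have "?y \<in> sphere 0 1" using False by simp
      then have "u \<bullet> (A *v u) * (norm x)\<^sup>2 \<le> ?y \<bullet> (A *v ?y) * (norm x)\<^sup>2"
        by (intro mult_right_mono u(2)[rule_format]) simp_all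
      also have "\<dots> = x \<bullet> (A *v x)"
      proof -
        have "?y \<bullet> (A *v ?y) = (inverse (norm x))\<^sup>2 * (x \<bullet> (A *v x))"
          by (simp add: matrix_vector_mult_scaleR power2_eq_square)
        then show ?thesis
          using False by (simp add: power_inverse)
      qed
      finally show ?thesis .
    qed simp
  qed
qed

text \<open>A finite set of index vectors lies in the box spanned by its coordinate projections.
  Over a box the sum factors, and each factor is at most the full one-dimensional sum.\<close>

lemma summable_on_prod_vec:
  fixes f :: "int \<Rightarrow> real"
  assumes "f summable_on UNIV" "\<And>k. f k \<ge> 0"
  shows "(\<lambda>n :: int^'g. \<Prod>i\<in>UNIV. f (n $ i)) summable_on UNIV"
proof (rule nonneg_bdd_above_summable_on)
  show "bdd_above (sum (\<lambda>n :: int^'g. \<Prod>i\<in>UNIV. f (n $ i)) ` {F. F \<subseteq> UNIV \<and> finite F})"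
  proof (rule bdd_aboveI2)
    fix F :: "(int^'g) set" assume "F \<in> {F. F \<subseteq> UNIV \<and> finite F}"
    then have F: "finite F" by simp
    let ?G = "\<lambda>i. (\<lambda>n. n $ i) ` F"
    have "(\<Sum>n\<in>F. \<Prod>i\<in>UNIV. f (n $ i)) = (\<Sum>h\<in>vec_nth ` F. \<Prod>i\<in>UNIV. f (h i))"
      by (subst sum.reindex) (auto simp: inj_on_def vec_nth_inject)
    also have "\<dots> \<le> (\<Sum>h\<in>PiE UNIV ?G. \<Prod>i\<in>UNIV. f (h i))"
      using F by (intro sum_mono2 finite_PiE) (auto intro!: prod_nonneg assms)
    also have "\<dots> = (\<Prod>i\<in>UNIV. \<Sum>k\<in>?G i. f k)"
      using F by (intro prod_sum_PiE[symmetric]) auto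
    also have "\<dots> \<le> (\<Prod>i\<in>(UNIV :: 'g set). infsum f UNIV)"
      using F assms by (intro prod_mono conjI sum_nonneg finite_sum_le_infsum) auto
    finally show "(\<Sum>n\<in>F. \<Prod>i\<in>UNIV. f (n $ i)) \<le> (\<Prod>i\<in>(UNIV :: 'g set). infsum f UNIV)" .
  qed
qed (auto intro: prod_nonneg assms)

lemma summable_on_exp_abs_int:
  assumes "c > 0"
  shows "(\<lambda>k::int. exp (- c * \<bar>of_int k\<bar>) :: real) summable_on UNIV"
proof -
  have eq: "exp (- c * real n) = exp (- c) ^ n" for n
    by (simp add: mult.commute flip: exp_of_nat_mult)
  have nat: "(\<lambda>n::nat. exp (- c * real n)) summable_on UNIV"
    unfolding eq
    by (subst summable_on_UNIV_nonneg_real_iff) (use assms in \<open>simp_all add: summable_geometric\<close>)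
  have "(\<lambda>k::int. exp (- c * \<bar>of_int k\<bar>) :: real) summable_on range int"
    "(\<lambda>k::int. exp (- c * \<bar>of_int k\<bar>) :: real) summable_on range (\<lambda>n. - int n)"
    using nat by (subst summable_on_reindex; simp add: o_def inj_on_def)+
  moreover have "range int \<union> range (\<lambda>n. - int n) = UNIV"
    by (auto intro: int_cases2)
  ultimately show ?thesis
    using summable_on_union by metis
qed

text \<open>The Fourier coefficients of \<theta> restricted to real vectors z.\<close>

definition theta_coeff :: "complex^'g^'g \<Rightarrow> int^'g \<Rightarrow> complex" where
  "theta_coeff \<tau> n = exp (of_real pi * \<i> * cdot (cvec (int_vec n)) (\<tau> *v cvec (int_vec n)))"

text \<open>The norm is exp(- pi n . Im(\<tau>) n). Positivity bounds the form below by c |n|^2, and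
  since integers satisfy |k| \<le> k^2, the Gaussian is dominated by a product of two-sided
  geometric series.\<close>

lemma theta_coeff_abs_summable:
  fixes \<tau> :: "complex^'g^'g"
  assumes "\<And>x. x \<noteq> 0 \<Longrightarrow> x \<bullet> (Im_mat \<tau> *v x) > 0"
  shows "(\<lambda>n. norm (theta_coeff \<tau> n)) summable_on UNIV"
proof -
  obtain c where c: "c > 0" "\<And>x. x \<bullet> (Im_mat \<tau> *v x) \<ge> c * (norm x)\<^sup>2"
    using pos_def_bound[OF assms] by blast
  have "norm (theta_coeff \<tau> n) \<le> (\<Prod>i\<in>UNIV. exp (- (pi * c) * \<bar>of_int (n $ i)\<bar>))" for n
  proof -
    have "Im (cdot (cvec x) (\<tau> *v cvec x)) = x \<bullet> (Im_mat \<tau> *v x)" for x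
      by (simp add: cdot_def cvec_def matrix_vector_mult_def Im_mat_def inner_vec_def
          sum_distrib_left)
    then have "norm (theta_coeff \<tau> n) = exp (- (pi * (int_vec n \<bullet> (Im_mat \<tau> *v int_vec n))))"
      by (simp add: theta_coeff_def)
    also have "\<dots> \<le> exp (- (pi * c) * (\<Sum>i\<in>UNIV. \<bar>of_int (n $ i)\<bar>))"
    proof -
      have "\<bar>real_of_int k\<bar> \<le> (of_int k)\<^sup>2" for k
      proof -
        have "\<bar>k\<bar> * 1 \<le> \<bar>k\<bar> * \<bar>k\<bar>"
          using mult_left_mono[of 1 "\<bar>k\<bar>" "\<bar>k\<bar>"] by (cases "k = 0") auto
        then have "real_of_int \<bar>k\<bar> \<le> real_of_int (\<bar>k\<bar> * \<bar>k\<bar>)"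
          by (subst of_int_le_iff) simp
        then show ?thesis by (simp add: power2_eq_square)
      qed
      then have "(\<Sum>i\<in>UNIV. \<bar>real_of_int (n $ i)\<bar>) \<le> (norm (int_vec n))\<^sup>2"
        unfolding power2_norm_eq_inner inner_vec_def int_vec_def
        by (intro sum_mono) (simp add: power2_eq_square)
      then have "c * (\<Sum>i\<in>UNIV. \<bar>real_of_int (n $ i)\<bar>) \<le> int_vec n \<bullet> (Im_mat \<tau> *v int_vec n)"
        using c(1) c(2)[of "int_vec n"] by (meson mult_left_mono order_trans less_imp_le)
      then show ?thesis
        by (simp add: mult.assoc)
    qed
    also have "\<dots> = (\<Prod>i\<in>UNIV. exp (- (pi * c) * \<bar>of_int (n $ i)\<bar>))"
      by (simp add: sum_distrib_left flip: exp_sum)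
    finally show ?thesis .
  qed
  moreover have "(\<lambda>n :: int^'g. \<Prod>i\<in>UNIV. exp (- (pi * c) * \<bar>of_int (n $ i)\<bar>) :: real) summable_on UNIV"
    using c by (intro summable_on_prod_vec summable_on_exp_abs_int) auto
  ultimately show ?thesis
    by (intro Infinite_Sum.abs_summable_on_comparison_test') auto
qed

text \<open>Averaging over the \<open>M\<close>-torsion points in the real torus isolates the coefficients with index
  in \<open>M\<int>\<^sup>g\<close>; for large \<open>M\<close> the constant term dominates the rest.\<close>

lemma sum_roots_of_unity:
  assumes "M > 0"
  shows "(\<Sum>k<M. exp (2 * of_real pi * \<i> * of_real (of_int n * real k / real M))) =
    (if int M dvd n then of_nat M else 0)"
proof -
  define \<zeta> where "\<zeta> = exp (2 * of_real pi * \<i> * of_real (of_int n / real M))"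
  have pow: "exp (2 * of_real pi * \<i> * of_real (of_int n * real k / real M)) = \<zeta> ^ k" for k
    by (simp add: \<zeta>_def mult_ac flip: exp_of_nat_mult)
  have "\<zeta> ^ M = 1"
    using assms pow[of M] exp_2pi_eq_1_iff[of "of_int n"] by simp
  moreover have "\<zeta> = 1 \<longleftrightarrow> int M dvd n"
  proof -
    have "\<zeta> = 1 \<longleftrightarrow> (\<exists>j. real_of_int n / real M = of_int j)"
      by (simp only: \<zeta>_def exp_2pi_eq_1_iff) (auto elim: Ints_cases)
    also have "\<dots> \<longleftrightarrow> (\<exists>j. n = int M * j)"
    proof -
      have "real_of_int n / real M = of_int j \<longleftrightarrow> n = int M * j" for j
      proof -
        have "real_of_int n / real M = of_int j \<longleftrightarrow> real_of_int n = real_of_int (int M * j)"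
          using assms by (simp add: field_simps)
        then show ?thesis by (simp only: of_int_eq_iff)
      qed
      then show ?thesis by simp
    qed
    finally show ?thesis by (simp add: dvd_def)
  qed
  ultimately show ?thesis
    unfolding pow by (auto simp: geometric_sum)
qed

lemma infsum_finite_sum_swap:
  fixes f :: "'a \<Rightarrow> 'b \<Rightarrow> complex"
  assumes "finite J" "\<And>j. j \<in> J \<Longrightarrow> f j summable_on A"
  shows "(\<Sum>j\<in>J. infsum (f j) A) = (\<Sum>\<^sub>\<infinity>n\<in>A. \<Sum>j\<in>J. f j n)"
    and "(\<lambda>n. \<Sum>j\<in>J. f j n) summable_on A"
  using assms by (induction J rule: finite_induct) (auto simp: infsum_add summable_on_add)

lemma theta_average:
  fixes \<tau> :: "complex^'g^'g"
  assumes summable: "(\<lambda>n. norm (theta_coeff \<tau> n)) summable_on UNIV" and M: "M > 0"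
  shows "(\<Sum>j\<in>PiE UNIV (\<lambda>_. {..<M}). theta_char 0 0 (cvec (\<chi> i. real (j i) / real M)) \<tau>) =
    of_nat M ^ CARD('g) * infsum (theta_coeff \<tau>) {n. \<forall>i. int M dvd n $ i}"
proof -
  let ?J = "PiE (UNIV :: 'g set) (\<lambda>_. {..<M})"
  let ?e = "\<lambda>j n. exp (2 * of_real pi * \<i> * of_real (int_vec n \<bullet> (\<chi> i. real (j i) / real M)))"
  have theta: "theta_char 0 0 (cvec x) \<tau> =
    (\<Sum>\<^sub>\<infinity>n\<in>UNIV. theta_coeff \<tau> n * exp (2 * of_real pi * \<i> * of_real (int_vec n \<bullet> x)))" for x
    by (simp add: theta_char_cdot theta_coeff_def cdot_cvec ring_distribs mult_ac
        flip: exp_add)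
  have "(\<lambda>n. theta_coeff \<tau> n * ?e j n) summable_on UNIV" for j
    by (rule abs_summable_summable) (use summable in \<open>simp add: norm_mult\<close>)
  then have "(\<Sum>j\<in>?J. theta_char 0 0 (cvec (\<chi> i. real (j i) / real M)) \<tau>) =
    (\<Sum>\<^sub>\<infinity>n\<in>UNIV. \<Sum>j\<in>?J. theta_coeff \<tau> n * ?e j n)"
    unfolding theta by (intro infsum_finite_sum_swap finite_PiE) auto
  also have "\<dots> = (\<Sum>\<^sub>\<infinity>n\<in>UNIV. theta_coeff \<tau> n *
      (if \<forall>i. int M dvd n $ i then of_nat M ^ CARD('g) else 0))"
  proof (rule infsum_cong)
    fix n :: "int^'g"
    have "?e j n = (\<Prod>i\<in>UNIV. exp (2 * of_real pi * \<i> * of_real (of_int (n $ i) * real (j i) / real M)))"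
      for j
      by (simp add: inner_vec_def int_vec_def sum_distrib_left flip: exp_sum)
    \<comment> \<open>The exponential factors over the coordinates, so the sum over torsion points
      becomes a product of sums over M-th roots of unity. It vanishes unless M divides every
      coordinate of n.\<close>
    then have "(\<Sum>j\<in>?J. ?e j n) =
      (\<Prod>i\<in>UNIV. \<Sum>k<M. exp (2 * of_real pi * \<i> * of_real (of_int (n $ i) * real k / real M)))"
      by (simp only:) (rule prod_sum_PiE[symmetric]; simp)
    also have "\<dots> = (\<Prod>i\<in>UNIV. if int M dvd n $ i then of_nat M else 0)"
      by (simp only: sum_roots_of_unity[OF M])
    also have "\<dots> = (if \<forall>i. int M dvd n $ i then of_nat M ^ CARD('g) else 0)"
      by auto
    finally show "(\<Sum>j\<in>?J. theta_coeff \<tau> n * ?e j n) =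
      theta_coeff \<tau> n * (if \<forall>i. int M dvd n $ i then of_nat M ^ CARD('g) else 0)"
      by (simp flip: sum_distrib_left)
  qed
  also have "\<dots> = (\<Sum>\<^sub>\<infinity>n\<in>{n. \<forall>i. int M dvd n $ i}. of_nat M ^ CARD('g) * theta_coeff \<tau> n)"
    by (rule infsum_cong_neutral) auto
  finally show ?thesis
    by (simp add: infsum_cmult_right')
qed

text \<open>If \<theta> vanished, so would the sum of its coefficients over the multiples of M. But
  the coefficient at 0 is 1, and for large M the others add up to at most 1/2 in norm.\<close>

lemma theta_not_identically_zero:
  fixes \<tau> :: "complex^'g^'g"
  assumes "\<And>x. x \<noteq> 0 \<Longrightarrow> x \<bullet> (Im_mat \<tau> *v x) > 0"
  shows "\<exists>z. theta_char 0 0 z \<tau> \<noteq> 0"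
proof (rule ccontr)
  assume "\<not> ?thesis"
  then have zero: "theta_char 0 0 z \<tau> = 0" for z by blast
  note s = theta_coeff_abs_summable[OF assms]
  let ?N = "\<lambda>n. norm (theta_coeff \<tau> n)"
  \<comment> \<open>Any bound below 1, the norm of the constant coefficient, would do for the
    tail.\<close>
  obtain F where F: "finite F" "dist (sum ?N F) (infsum ?N UNIV) \<le> 1/2"
    using has_sum_finite_approximation[OF has_sum_infsum[OF s], of "1/2"] by auto
  have "infsum ?N UNIV - sum ?N F \<le> 1/2"
    using F(2) unfolding dist_real_def by linarith
  then have tail: "infsum ?N (- F) \<le> 1/2"
    using infsum_Diff[OF s summable_on_finite[OF F(1)]] F(1)
    by (simp add: Compl_eq_Diff_UNIV)
  \<comment> \<open>The total sum bounds every entry of every vector in \<open>F\<close>, and the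
    summand 1 makes the bound strict and M positive. A non-zero vector with all entries divisible by
    M has an entry of size at least M, so it lies outside \<open>F\<close>.\<close>
  define M where "M = nat (1 + (\<Sum>n\<in>F. \<Sum>i\<in>UNIV. \<bar>n $ i\<bar>))"
  have nonneg: "0 \<le> (\<Sum>n\<in>F. \<Sum>i\<in>UNIV. \<bar>n $ i\<bar>)"
    by (intro sum_nonneg) simp
  then have M: "M > 0" "int M = 1 + (\<Sum>n\<in>F. \<Sum>i\<in>UNIV. \<bar>n $ i\<bar>)"
    by (simp_all add: M_def)
  define D where "D = {n :: int^'g. \<forall>i. int M dvd n $ i}"
  have D: "D - {0} \<subseteq> - F"
  proof
    fix n assume n: "n \<in> D - {0}"
    then obtain i where i: "n $ i \<noteq> 0" by (auto simp: vec_eq_iff)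
    have "int M \<le> \<bar>n $ i\<bar>"
      using n i by (intro zdvd_imp_le) (auto simp: D_def)
    moreover have "\<bar>n $ i\<bar> < int M" if "n \<in> F"
    proof -
      have "\<bar>n $ i\<bar> \<le> (\<Sum>i\<in>UNIV. \<bar>n $ i\<bar>)"
        by (rule member_le_sum) auto
      also have "\<dots> \<le> (\<Sum>n\<in>F. \<Sum>i\<in>UNIV. \<bar>n $ i\<bar>)"
        using that F(1) by (intro member_le_sum[of n F "\<lambda>n :: int^'g. \<Sum>i\<in>UNIV. \<bar>n $ i\<bar>"] sum_nonneg) auto
      finally show ?thesis by (simp add: M)
    qed
    ultimately show "n \<in> - F" by auto
  qed
  have sub: "?N summable_on A" for A
    using s summable_on_subset by blast
  have "infsum (theta_coeff \<tau>) D = 0"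
    using theta_average[OF s M(1)] M(1) zero by (simp add: D_def)
  moreover have "infsum (theta_coeff \<tau>) (insert 0 (D - {0})) =
      theta_coeff \<tau> 0 + infsum (theta_coeff \<tau>) (D - {0})"
    by (rule infsum_insert[OF abs_summable_summable[OF sub]]) simp
  moreover have "insert 0 (D - {0}) = D" by (auto simp: D_def)
  ultimately have sum: "theta_coeff \<tau> 0 + infsum (theta_coeff \<tau>) (D - {0}) = 0"
    by simp
  have "int_vec 0 = (0 :: real^'g)" by (simp add: int_vec_def vec_eq_iff)
  then have "theta_coeff \<tau> 0 = 1" by (simp add: theta_coeff_def)
  then have "norm (infsum (theta_coeff \<tau>) (D - {0})) = 1"
    using minus_unique[OF sum] by (metis norm_minus_cancel norm_one)
  moreover have "norm (infsum (theta_coeff \<tau>) (D - {0})) \<le> 1/2"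
    using norm_infsum_bound[OF sub] infsum_mono2[OF sub sub D] tail
    by (smt (verit) norm_ge_zero)
  ultimately show False by simp
qed

section \<open>Calculus of extended values: translates, products, comparison\<close>

lemma entire_mult_nonzero:
  assumes "holo_on f UNIV" "f z \<noteq> 0" "holo_on g UNIV" "g w \<noteq> 0"
  shows "\<exists>x. f x * g x \<noteq> 0"
proof -
  have "open (f -` (- {0}))"
    by (intro open_vimage holo_on_imp_continuous_on assms open_Compl closed_singleton)
  then obtain x where "x \<in> f -` (- {0})" "g x \<noteq> 0"
    using entire_nonzero_dense[OF assms(3,4), of "f -` (- {0})" z] assms(2) by auto
  then show ?thesis by auto
qed

lemma extends_to_translate:
  assumes "extends_to u k (z - p) c"
  shows "extends_to (\<lambda>z. u (z - p)) (\<lambda>z. k (z - p)) z c"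
proof -
  obtain U h where U: "open U" "z - p \<in> U" "holo_on h U"
    "\<forall>w\<in>U. k w \<noteq> 0 \<longrightarrow> h w = u w / k w" "h (z - p) = c"
    using assms by (auto simp: extends_to_def)
  have "open {z. z - p \<in> U}"
    using open_vimage[OF U(1), of "\<lambda>z. z - p"] by (simp add: vimage_def continuous_on_diff)
  then show ?thesis
    unfolding extends_to_def using U holo_on_translate[OF U(3), of p]
    by (intro exI[of _ "{z. z - p \<in> U}"] exI[of _ "\<lambda>z. h (z - p)"]) simp
qed

lemma extends_to_mult:
  assumes "extends_to u k z c" "extends_to v l z d"
  shows "extends_to (\<lambda>z. u z * v z) (\<lambda>z. k z * l z) z (c * d)"
proof -
  obtain U h where U: "open U" "z \<in> U" "holo_on h U"
    "\<forall>w\<in>U. k w \<noteq> 0 \<longrightarrow> h w = u w / k w" "h z = c"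
    using assms(1) by (auto simp: extends_to_def)
  obtain V g where V: "open V" "z \<in> V" "holo_on g V"
    "\<forall>w\<in>V. l w \<noteq> 0 \<longrightarrow> g w = v w / l w" "g z = d"
    using assms(2) by (auto simp: extends_to_def)
  show ?thesis
    unfolding extends_to_def using U V
    by (intro exI[of _ "U \<inter> V"] exI[of _ "\<lambda>z. h z * g z"])
      (auto intro: holo_on_mult holo_on_subset)
qed

lemma extends_to_const: "extends_to (\<lambda>z. c) (\<lambda>z. 1) z c"
  unfolding extends_to_def by (intro exI[of _ UNIV] exI[of _ "\<lambda>z. c"]) simp

lemma extends_to_self: "extends_to k k z 1"
  unfolding extends_to_def by (intro exI[of _ UNIV] exI[of _ "\<lambda>z. 1"]) simp

text \<open>Turns an identity between quotients into a cross-multiplied identity of functions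
  defined everywhere. The germs agree where k l is non-zero, and density carries the equality to
  zeros of the denominators.\<close>

lemma extends_to_eq:
  assumes "extends_to u k z c" "extends_to v l z d"
    and k: "holo_on k UNIV" "k z1 \<noteq> 0" and l: "holo_on l UNIV" "l z2 \<noteq> 0"
    and eq: "\<And>w. u w * l w = v w * k w"
  shows "c = d"
proof -
  obtain U h where U: "open U" "z \<in> U" "holo_on h U"
    "\<forall>w\<in>U. k w \<noteq> 0 \<longrightarrow> h w = u w / k w" "h z = c"
    using assms(1) by (auto simp: extends_to_def)
  obtain V g where V: "open V" "z \<in> V" "holo_on g V"
    "\<forall>w\<in>V. l w \<noteq> 0 \<longrightarrow> g w = v w / l w" "g z = d"
    using assms(2) by (auto simp: extends_to_def)
  obtain z0 where z0: "k z0 * l z0 \<noteq> 0"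
    using entire_mult_nonzero[OF k l] by blast
  have "h z = g z"
  proof (rule eq_by_density[OF holo_on_mult[OF k(1) l(1)] z0, of "U \<inter> V"])
    show "h w = g w" if "w \<in> U \<inter> V" "k w * l w \<noteq> 0" for w
      using that U(4) V(4) eq[of w] by (simp add: frac_eq_eq)
  qed (use U V in \<open>auto intro: holo_on_imp_continuous_on holo_on_subset\<close>)
  then show ?thesis
    using U V by simp
qed

text \<open>Since \<theta> is only quasi-periodic, periodicity is asked of the zero set of the
  denominator and of the quotient, not of \<open>u\<close> and \<open>k\<close> separately.\<close>

lemma extends_to_periodic:
  assumes zero: "\<And>w. k (w + l) = 0 \<longleftrightarrow> k w = 0"
    and eq: "\<And>w. u (w + l) / k (w + l) = u w / k w"
    and z: "extends_to u k z c"
  shows "extends_to u k (z + l) c"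
proof -
  have "k w = 0 \<longleftrightarrow> k (w - l) = 0" "u w / k w = u (w - l) / k (w - l)" for w
    using zero[of "w - l"] eq[of "w - l"] by simp_all
  moreover have "extends_to (\<lambda>w. u (w - l)) (\<lambda>w. k (w - l)) (z + l) c"
    using extends_to_translate[of u k "z + l" l c] z by simp
  ultimately show ?thesis
    unfolding extends_to_def by auto
qed

section \<open>Theta quotients of level \<open>N\<close>\<close>

lemma level_coord_inner:
  assumes "level_coord N a" "int_coord b"
  shows "of_nat N * (a \<bullet> b) \<in> \<int>"
proof -
  have "of_nat N * (a \<bullet> b) = (of_nat N *\<^sub>R a) \<bullet> b"
    by simp
  then show ?thesis
    using assms by (simp only:) (intro inner_Ints; simp add: level_coord_def)
qed

lemma level_coord_add: "level_coord N a \<Longrightarrow> level_coord N b \<Longrightarrow> level_coord N (a + b)"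
  by (simp add: level_coord_def distrib_left)

lemma level_coord_minus: "level_coord N a \<Longrightarrow> level_coord N (- a)"
  by (simp add: level_coord_def)

lemma level_coord_0: "level_coord N 0"
  by (simp add: level_coord_def)

lemma level_coord_Ints:
  shows "int_coord a \<Longrightarrow> level_coord N a"
  by (simp add: level_coord_def)

text \<open>This is where the exponent N acts: it kills the roots of unity by which theta quotients
  at torsion points fail to be well defined.\<close>

lemma exp_level:
  assumes "level_coord N a" "int_coord b"
  shows "exp (2 * of_real pi * \<i> * of_real (a \<bullet> b)) ^ N = 1"
proof -
  have "exp (2 * of_real pi * \<i> * of_real (a \<bullet> b)) ^ N =
    exp (2 * of_real pi * \<i> * of_real (of_nat N * (a \<bullet> b)))"
    by (simp add: mult_ac flip: exp_of_nat_mult)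
  then show ?thesis
    using level_coord_inner[OF assms] by (simp only: exp_2pi_eq_1_iff)
qed

locale theta_quotient =
  fixes \<tau> :: "complex^'g^'g" and N :: nat
  assumes symmetric: "transpose \<tau> = \<tau>"
    and entire: "holo_on (\<lambda>z. theta_char 0 0 z \<tau>) UNIV"
    and nonzero: "\<exists>z. theta_char 0 0 z \<tau> \<noteq> 0"
begin

abbreviation \<theta> :: "complex^'g \<Rightarrow> complex" where
  "\<theta> z \<equiv> theta_char 0 0 z \<tau>"

definition unit :: "real^'g \<Rightarrow> real^'g \<Rightarrow> complex^'g \<Rightarrow> complex" where
  "unit a b z = exp (of_real pi * \<i> * (2 * cdot (cvec (- a)) (z - cvec b) + cdot (cvec a) (\<tau> *v cvec a)))"

definition num :: "real^'g \<Rightarrow> real^'g \<Rightarrow> complex^'g \<Rightarrow> complex" where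
  "num a b z = theta_char (- a) (- b) z \<tau> ^ N"

definition quot :: "real^'g \<Rightarrow> real^'g \<Rightarrow> complex^'g \<Rightarrow> complex option" where
  "quot a b = holo_quotient (num a b) (\<lambda>z. \<theta> z ^ N)"

lemma theta_char_minus: "theta_char (- a) (- b) z \<tau> = unit a b z * \<theta> (z - period_pt \<tau> a b)"
  using theta_char_eq_theta[OF symmetric, of "- a" "- b" z]
  by (simp add: unit_def period_pt_minus matrix_vector_minus)

lemma num_eq: "num a b z = unit a b z ^ N * \<theta> (z - period_pt \<tau> a b) ^ N"
  by (simp add: num_def theta_char_minus power_mult_distrib)

lemma holo_theta_translate: "holo_on (\<lambda>z. \<theta> (z - p)) UNIV"
  using holo_on_translate[OF entire] by simp

lemma holo_unit: "holo_on (unit a b) UNIV"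
proof -
  have "holo_on (\<lambda>z. cdot (cvec (- a)) (z - cvec b)) UNIV"
    using holo_on_translate[OF holo_on_cdot[of "cvec (- a)" UNIV], of "cvec b"] by simp
  then show ?thesis
    unfolding unit_def[abs_def] by (intro holo_on_exp holo_on_mult holo_on_add holo_on_const)
qed

lemma holo_num: "holo_on (num a b) UNIV"
  unfolding num_eq[abs_def] by (intro holo_on_mult holo_on_power holo_unit holo_theta_translate)

lemma holo_denom: "holo_on (\<lambda>z. \<theta> z ^ N) UNIV"
  by (intro holo_on_power entire)

lemma denom_nonzero: "\<exists>z. \<theta> z ^ N \<noteq> 0"
  using nonzero by auto

lemma num_add_Ints:
  assumes "level_coord N a" "int_coord m" "int_coord k"
  shows "num (a + m) (b + k) z = num a b z"
proof -
  have "theta_char (- m + - a) (- k + - b) z \<tau> =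
      exp (of_real pi * \<i> * (2 * cdot (cvec (- a)) (z + cvec (- k) + cvec (- b)) + cdot (cvec (- a)) (\<tau> *v cvec (- a)))) *
      \<theta> (z - period_pt \<tau> a b)"
    using theta_char_Ints[of "- m" "- k"] assms theta_char_add[OF symmetric, of "- m" "- a" "- k" "- b" z]
    by (simp add: period_pt_minus)
  also have "of_real pi * \<i> * (2 * cdot (cvec (- a)) (z + cvec (- k) + cvec (- b)) + cdot (cvec (- a)) (\<tau> *v cvec (- a))) =
      of_real pi * \<i> * (2 * cdot (cvec (- a)) (z - cvec b) + cdot (cvec a) (\<tau> *v cvec a)) +
      2 * of_real pi * \<i> * of_real (a \<bullet> k)"
    by (simp add: matrix_vector_minus algebra_simps flip: cdot_cvec)
  also have "- m + - a = - (a + m)"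
    by simp
  also have "- k + - b = - (b + k)"
    by simp
  finally have "theta_char (- (a + m)) (- (b + k)) z \<tau> =
      exp (2 * of_real pi * \<i> * of_real (a \<bullet> k)) * (unit a b z * \<theta> (z - period_pt \<tau> a b))"
    by (simp add: exp_add unit_def mult_ac)
  then show ?thesis
    using exp_level[OF assms(1,3)] by (simp add: num_def theta_char_minus power_mult_distrib)
qed

text \<open>Under the period \<tau>m + k, \<open>unit\<close> gains exp(-2 pi i (m . \<tau>a + a .
  k)), and the automorphy factor of the translated \<theta> exceeds that of \<theta> by exp(2 pi i
  (m . \<tau>a + b . m)). The terms in \<tau> cancel, and the N-th power removes exp(2 pi i (b . m -
  a . k)).\<close>

lemma quot_periodic:
  assumes "level_coord N a" "level_coord N b" "int_coord m" "int_coord k"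
  shows "quot a b (z + period_pt \<tau> m k) = quot a b z"
proof -
  have step: "extends_to (num a b) (\<lambda>z. \<theta> z ^ N) (z + period_pt \<tau> m k) c"
    if "extends_to (num a b) (\<lambda>z. \<theta> z ^ N) z c" "int_coord m" "int_coord k" for z c m k
  proof (rule extends_to_periodic[OF _ _ that(1)])
    fix w
    let ?l = "period_pt \<tau> m k" and ?p = "period_pt \<tau> a b"
    define c where "c w = exp (- (of_real pi * \<i> * (2 * cdot (cvec m) w + cdot (cvec m) (\<tau> *v cvec m))))" for w
    have period: "\<theta> (w + ?l) = c w * \<theta> w" for w
      using theta_quasi_periodic[OF symmetric that(2,3)] by (simp add: c_def)
    have c: "c w \<noteq> 0" for w by (simp add: c_def)
    show "\<theta> (w + ?l) ^ N = 0 \<longleftrightarrow> \<theta> w ^ N = 0"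
      using period c by simp
    have "c (w - ?p) = c w * exp (2 * of_real pi * \<i> * (cdot (cvec m) (\<tau> *v cvec a) + of_real (b \<bullet> m)))"
      by (simp add: c_def period_pt_eq algebra_simps cdot_commute[of "cvec b" "cvec m"] flip: exp_add cdot_cvec)
    moreover have "unit a b (w + ?l) = unit a b w *
        exp (- (2 * of_real pi * \<i> * (cdot (cvec m) (\<tau> *v cvec a) + of_real (a \<bullet> k))))"
      by (simp add: unit_def period_pt_eq algebra_simps cdot_matrix_commute[OF symmetric, of "cvec m"]
          flip: exp_add cdot_cvec)
    ultimately have "unit a b (w + ?l) * c (w - ?p) = unit a b w * c w *
        (exp (2 * of_real pi * \<i> * of_real (b \<bullet> m)) / exp (2 * of_real pi * \<i> * of_real (a \<bullet> k)))"
      by (simp add: exp_add exp_minus exp_diff distrib_left field_simps)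
    then have "(unit a b (w + ?l) * c (w - ?p)) ^ N = (unit a b w * c w) ^ N"
      using exp_level[OF assms(2) that(2)] exp_level[OF assms(1) that(3)]
      by (simp add: power_mult_distrib power_divide)
    moreover have "num a b (w + ?l) = (unit a b (w + ?l) * c (w - ?p)) ^ N * \<theta> (w - ?p) ^ N"
      using period[of "w - ?p"] by (simp add: num_eq power_mult_distrib algebra_simps)
    ultimately have "num a b (w + ?l) = c w ^ N * num a b w"
      by (simp add: num_eq power_mult_distrib)
    then show "num a b (w + ?l) / \<theta> (w + ?l) ^ N = num a b w / \<theta> w ^ N"
      using c[of w] period[of w] by (simp add: power_mult_distrib)
  qed
  \<comment> \<open>Translating back by (-m, -k) gives the converse, so the points without a value
    correspond as well.\<close>
  have "extends_to (num a b) (\<lambda>z. \<theta> z ^ N) (z + period_pt \<tau> m k) c \<longleftrightarrow>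
      extends_to (num a b) (\<lambda>z. \<theta> z ^ N) z c" for c
    using step[of z c m k] step[of "z + period_pt \<tau> m k" c "- m" "- k"] assms
    by (auto simp: period_pt_minus)
  then have "extends_to (num a b) (\<lambda>z. \<theta> z ^ N) (z + period_pt \<tau> m k) =
      extends_to (num a b) (\<lambda>z. \<theta> z ^ N) z"
    by (rule ext)
  then show ?thesis
    by (simp add: quot_def holo_quotient_def)
qed

lemma quot_eq_Some_iff: "quot a b z = Some c \<longleftrightarrow> extends_to (num a b) (\<lambda>z. \<theta> z ^ N) z c"
  using holo_quotient_eq_Some_iff[OF holo_num holo_denom] denom_nonzero
  unfolding quot_def by blast

lemma quot_nonzero:
  assumes "\<theta> z \<noteq> 0"
  shows "quot a b z = Some (num a b z / \<theta> z ^ N)"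
  using holo_quotient_nonzero[OF holo_num holo_denom, of _ z] denom_nonzero assms
  unfolding quot_def by auto

lemma meromorphic_map_quot: "meromorphic_map (quot a b)"
  using meromorphic_map_holo_quotient[OF holo_num holo_denom] denom_nonzero
  unfolding quot_def by blast

lemma quot_0: "quot 0 0 z = Some 1"
  unfolding quot_eq_Some_iff num_def by (simp add: extends_to_self)

text \<open>Origin of the scalar in \<open>d_transp\<close>: in the product of the two units the
  cross terms in \<tau> cancel by symmetry. The first unit pairs \<open>a\<close> with z - b instead
  of z - b - f, and this leaves exp(-2 pi i a . f), to be raised to the power N.\<close>

lemma num_mult:
  "num a b z * num e f (z - period_pt \<tau> a b) =
    exp (- (2 * of_real pi * \<i> * of_nat N * of_real (a \<bullet> f))) * num (a + e) (b + f) z *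
    \<theta> (z - period_pt \<tau> a b) ^ N"
proof -
  have "unit a b z * unit e f (z - period_pt \<tau> a b) =
      exp (- (2 * of_real pi * \<i> * of_real (a \<bullet> f))) * unit (a + e) (b + f) z"
    by (simp add: unit_def period_pt_eq algebra_simps matrix_vector_right_distrib
        cdot_matrix_commute[OF symmetric, of "cvec e" "cvec a"] flip: exp_add cdot_cvec)
  then have "(unit a b z * unit e f (z - period_pt \<tau> a b)) ^ N =
      (exp (- (2 * of_real pi * \<i> * of_real (a \<bullet> f))) * unit (a + e) (b + f) z) ^ N"
    by simp
  moreover have "exp (- (2 * of_real pi * \<i> * of_real (a \<bullet> f))) ^ N =
      exp (- (2 * of_real pi * \<i> * of_nat N * of_real (a \<bullet> f)))"
    by (simp add: mult_ac flip: exp_of_nat_mult)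
  ultimately show ?thesis
    by (simp add: num_eq power_mult_distrib period_pt_add diff_diff_add mult_ac)
qed

text \<open>After cross multiplication this is \<open>num_mult\<close>. The germ argument covers
  points where \<theta>(z) or \<theta>(z - p), for the point p of (a, b), vanishes while all three
  values exist.\<close>

lemma quot_mult:
  assumes "quot a b z = Some c1" "quot e f (z - period_pt \<tau> a b) = Some c2"
    "quot (a + e) (b + f) z = Some c3"
  shows "c1 * c2 = exp (- (2 * of_real pi * \<i> * of_nat N * of_real (a \<bullet> f))) * c3"
proof -
  let ?p = "period_pt \<tau> a b" and ?d = "exp (- (2 * of_real pi * \<i> * of_nat N * of_real (a \<bullet> f)))"
  obtain z0 where z0: "\<theta> z0 \<noteq> 0" using nonzero by blast
  have 1: "extends_to (\<lambda>z. num a b z * num e f (z - ?p)) (\<lambda>z. \<theta> z ^ N * \<theta> (z - ?p) ^ N) z (c1 * c2)"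
    using assms(1,2) unfolding quot_eq_Some_iff by (intro extends_to_mult extends_to_translate)
  have 2: "extends_to (\<lambda>z. ?d * num (a + e) (b + f) z) (\<lambda>z. 1 * \<theta> z ^ N) z (?d * c3)"
    using assms(3) unfolding quot_eq_Some_iff by (intro extends_to_mult extends_to_const)
  have holo: "holo_on (\<lambda>z. \<theta> z ^ N * \<theta> (z - ?p) ^ N) UNIV" "holo_on (\<lambda>z. 1 * \<theta> z ^ N) UNIV"
    by (intro holo_on_mult holo_on_power holo_theta_translate entire holo_on_const)+
  have "\<exists>z. \<theta> z ^ N * \<theta> (z - ?p) ^ N \<noteq> 0"
    by (rule entire_mult_nonzero[of _ z0 _ "z0 + ?p"])
      (auto intro!: holo_on_power entire holo_theta_translate simp: z0)
  then obtain z1 where z1: "\<theta> z1 ^ N * \<theta> (z1 - ?p) ^ N \<noteq> 0" ..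
  have z2: "1 * \<theta> z0 ^ N \<noteq> 0" using z0 by simp
  show ?thesis
    by (rule extends_to_eq[OF 1 2 holo(1) z1 holo(2) z2]) (simp add: num_mult)
qed

end

section \<open>The normal Weil set\<close>

locale jacobian_theta =
  fixes C :: "(complex^'n) set set" and \<pi> :: "complex^'g \<Rightarrow> 'n divisor set"
    and E :: "complex^'g \<Rightarrow> complex^'g \<Rightarrow> real" and \<tau> :: "complex^'g^'g"
    and \<delta> :: "'n divisor set" and N :: nat and d :: int
  assumes curve: "smooth_projective_curve C"
    and jacobian: "jacobian_uniformization C \<pi>"
    and polarization: "theta_polarization C \<pi> E"
    and periods: "symplectic_period_matrix \<pi> E \<tau>"
    and delta: "\<delta> \<in> Jac C d" "riemann_theta_characteristic C \<pi> \<tau> \<delta>"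
    and N: "N > 0"
begin

lemmas principal = principal_divisor_0[OF curve] jacobian_principal_add[OF curve jacobian]
lemmas cls_add = cls_add_div_class[OF principal]
lemmas cls_diff = cls_diff_div_class[OF principal]
lemmas cls_eq_iff = div_class_eq_iff[OF principal]

lemma E_form: "bilinear E" "E u u = 0"
  using polarization by (auto simp: theta_polarization_def)

lemma E_period_pt: "E (period_pt \<tau> a b) (period_pt \<tau> c e) = a \<bullet> e - b \<bullet> c"
  by (rule symplectic_form_period_pt[OF E_form periods])

lemma period_pt_inject: "period_pt \<tau> a b = period_pt \<tau> c e \<longleftrightarrow> a = c \<and> b = e"
  using period_pt_eq_0_iff[OF E_form periods, of "a - c" "b - e"] by (simp add: period_pt_diff)

sublocale theta_quotient \<tau> N
proof
  have J: "E (\<i> *s u) (\<i> *s v) = E u v" and pos: "u \<noteq> 0 \<Longrightarrow> E (\<i> *s u) u > 0" for u v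
    using polarization by (auto simp: theta_polarization_def)
  show "transpose \<tau> = \<tau>"
    by (rule riemann_relations(1)[OF E_form periods J pos])
  show "\<exists>z. theta_char 0 0 z \<tau> \<noteq> 0"
    by (rule theta_not_identically_zero) (rule riemann_relations(2)[OF E_form periods J pos])
  \<comment> \<open>Read off from the characterization of \<delta> instead of by differentiating the
    series.\<close>
  show "holo_on (\<lambda>z. theta_char 0 0 z \<tau>) UNIV"
    using delta(2) by (simp add: riemann_theta_characteristic_def reduced_equation_def)
qed

section \<open>The covering of X and torsion points in period coordinates\<close>

lemma pi_rep: obtains D where "divisor_on C D" "\<pi> z = div_class C D"
proof -
  have "\<pi> z \<in> Jac C 0"
    using jacobian by (auto simp: jacobian_uniformization_def)
  then show ?thesis using that by (auto simp: Jac_def)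
qed

lemma delta_rep: obtains D where "divisor_on C D" "\<delta> = div_class C D"
  using delta(1) by (auto simp: Jac_def)

lemma pi_add: "\<pi> (z + w) = cls_add (\<pi> z) (\<pi> w)"
  using jacobian by (simp add: jacobian_uniformization_def)

lemma pi_diff: "cls_diff (\<pi> z) (\<pi> w) = \<pi> (z - w)"
proof -
  obtain D E where D: "divisor_on C D" "\<pi> (z - w) = div_class C D"
    and E: "divisor_on C E" "\<pi> w = div_class C E" by (metis pi_rep)
  have "\<pi> z = div_class C (D + E)"
    using pi_add[of "z - w" w] D E by (simp add: cls_add)
  then show ?thesis
    using D E by (simp add: cls_diff divisor_on_add)
qed

lemma pi_eq_iff_diff: "\<pi> z = \<pi> w \<longleftrightarrow> \<pi> (z - w) = \<pi> 0"
proof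
  assume "\<pi> z = \<pi> w"
  then show "\<pi> (z - w) = \<pi> 0"
    using pi_diff[of z w] pi_diff[of w w] by simp
next
  assume "\<pi> (z - w) = \<pi> 0"
  then show "\<pi> z = \<pi> w"
    using pi_add[of "z - w" w] pi_add[of 0 w] by simp
qed

lemma pi_eq_0_iff: "\<pi> z = \<pi> 0 \<longleftrightarrow> (\<exists>m k. z = period_pt \<tau> m k \<and> int_coord m \<and> int_coord k)"
proof -
  have "{z. \<pi> z = \<pi> 0} = {period_pt \<tau> m k | m k. \<forall>i. m $ i \<in> \<int> \<and> k $ i \<in> \<int>}"
    using periods by (simp add: symplectic_period_matrix_def)
  then have "z \<in> {z. \<pi> z = \<pi> 0} \<longleftrightarrow> z \<in> {period_pt \<tau> m k | m k. \<forall>i. m $ i \<in> \<int> \<and> k $ i \<in> \<int>}"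
    by (rule arg_cong)
  then show ?thesis
    by (simp add: all_conj_distrib)
qed

lemma pi_eqE:
  assumes "\<pi> z = \<pi> w"
  obtains m k where "z = w + period_pt \<tau> m k" "int_coord m" "int_coord k"
proof -
  obtain m k where "z - w = period_pt \<tau> m k" "int_coord m" "int_coord k"
    using assms pi_eq_iff_diff[of z w] pi_eq_0_iff by auto
  then show ?thesis
    using that[of m k] by (simp add: algebra_simps)
qed

abbreviation X :: "complex^'g \<Rightarrow> 'n divisor set" where
  "X \<equiv> X_cover \<pi> \<delta>"

lemma X_eq_iff: "X z = X w \<longleftrightarrow> \<pi> z = \<pi> w"
proof
  obtain D A B where D: "divisor_on C D" "\<delta> = div_class C D"
    and A: "divisor_on C A" "\<pi> z = div_class C A" and B: "divisor_on C B" "\<pi> w = div_class C B"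
    by (metis pi_rep delta_rep)
  assume "X z = X w"
  then show "\<pi> z = \<pi> w"
    using D A B by (simp add: X_cover_def cls_add cls_eq_iff divisor_on_add)
qed (simp add: X_cover_def)

lemma X_diff: "cls_diff (X z) (\<pi> w) = X (z - w)"
proof -
  obtain D A B where D: "divisor_on C D" "\<delta> = div_class C D"
    and A: "divisor_on C A" "\<pi> (z - w) = div_class C A" and B: "divisor_on C B" "\<pi> w = div_class C B"
    by (metis pi_rep delta_rep)
  have "\<pi> z = div_class C (A + B)"
    using pi_add[of "z - w" w] A B by (simp add: cls_add)
  then have "cls_diff (X z) (\<pi> w) = div_class C (D + (A + B) - B)"
    using D A B by (simp add: X_cover_def cls_add cls_diff divisor_on_add)
  also have "\<dots> = X (z - w)"
    using D A B by (simp add: X_cover_def cls_add)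
  finally show ?thesis .
qed

lemma X_0: "X 0 = \<delta>"
proof -
  obtain D A where D: "divisor_on C D" "\<delta> = div_class C D"
    and A: "divisor_on C A" "\<pi> 0 = div_class C A"
    by (metis pi_rep delta_rep)
  have "div_class C A = div_class C (A - A)"
    using pi_diff[of 0 0] A by (simp add: cls_diff)
  then have "\<pi> 0 = div_class C 0" using A by simp
  then show ?thesis
    using D by (simp add: X_cover_def cls_add divisor_on_0)
qed

lemma cls_diff_cls_add:
  assumes "divisor_on C K"
  shows "cls_diff (cls_add (div_class C K) \<delta>) (div_class C K) = \<delta>"
proof -
  obtain D where D: "divisor_on C D" "\<delta> = div_class C D" by (rule delta_rep)
  then show ?thesis
    using assms by (simp add: cls_add cls_diff divisor_on_add)
qed

text \<open>If N z is a period, the coordinates of z are integers divided by N, and any other lift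
  differs by integers. The arbitrary lift \<open>u\<close> matters because
  \<open>splits_weil_pairing\<close> compares \<open>E\<close> on all lifts.\<close>

lemma torsionE:
  assumes "\<pi> u \<in> jac_torsion N \<pi>"
  obtains a b where "level_coord N a" "level_coord N b" "u = period_pt \<tau> a b"
proof -
  obtain z where z: "\<pi> u = \<pi> z" "\<pi> (of_nat N *s z) = \<pi> 0"
    using assms by (auto simp: jac_torsion_def)
  obtain m k where mk: "of_nat N *s z = period_pt \<tau> m k" "int_coord m" "int_coord k"
    using z(2) pi_eq_0_iff by auto
  have "z = inverse (of_nat N) *\<^sub>R (of_nat N *s z)"
    using N by (simp add: vec_eq_iff scaleR_conv_of_real[where 'a = complex])
  also have "\<dots> = period_pt \<tau> (inverse (of_nat N) *\<^sub>R m) (inverse (of_nat N) *\<^sub>R k)"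
    by (simp only: mk period_pt_scale)
  finally have z': "z = period_pt \<tau> (inverse (of_nat N) *\<^sub>R m) (inverse (of_nat N) *\<^sub>R k)" .
  obtain m' k' where mk': "u = z + period_pt \<tau> m' k'" "int_coord m'" "int_coord k'"
    using z(1) by (rule pi_eqE)
  have level: "level_coord N (inverse (of_nat N) *\<^sub>R m)" if "int_coord m" for m
    using that N by (simp add: level_coord_def flip: mult.assoc)
  show ?thesis
  proof (rule that)
    show "level_coord N (inverse (of_nat N) *\<^sub>R m + m')" "level_coord N (inverse (of_nat N) *\<^sub>R k + k')"
      by (intro level_coord_add level mk level_coord_Ints mk')+
    show "u = period_pt \<tau> (inverse (of_nat N) *\<^sub>R m + m') (inverse (of_nat N) *\<^sub>R k + k')"
      using mk' z' by (simp add: period_pt_add)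
  qed
qed

lemma torsion_cases:
  assumes "P \<in> jac_torsion N \<pi>"
  obtains a b where "level_coord N a" "level_coord N b" "P = \<pi> (period_pt \<tau> a b)"
proof -
  obtain u where u: "P = \<pi> u"
    using assms by (auto simp: jac_torsion_def)
  show ?thesis
    by (rule torsionE[of u]) (use assms u that in auto)
qed

lemma pi_period_pt_eqE:
  assumes "\<pi> (period_pt \<tau> a' b') = \<pi> (period_pt \<tau> a b)"
  obtains m k where "a' = a + m" "b' = b + k" "int_coord m" "int_coord k"
  using assms
proof (rule pi_eqE)
  fix m k
  assume "period_pt \<tau> a' b' = period_pt \<tau> a b + period_pt \<tau> m k" "int_coord m" "int_coord k"
  then show thesis
    using that[of m k] by (simp add: period_pt_inject flip: period_pt_add)
qed

section \<open>The pairing on torsion points\<close>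

lemma exp_level_cong:
  assumes "level_coord N a" "level_coord N b" "int_coord m" "int_coord k"
  shows "exp (2 * of_real pi * \<i> * of_nat N * of_real ((a + m) \<bullet> (b + k))) =
    exp (2 * of_real pi * \<i> * of_nat N * of_real (a \<bullet> b))"
proof -
  have "of_nat N * (b \<bullet> m) + of_nat N * ((a + m) \<bullet> k) \<in> \<int>"
    by (intro Ints_add level_coord_inner[OF assms(2,3)]
        level_coord_inner[OF level_coord_add[OF assms(1) level_coord_Ints[OF assms(3)]] assms(4)])
  then have "exp (2 * of_real pi * \<i> * of_real (of_nat N * (b \<bullet> m) + of_nat N * ((a + m) \<bullet> k))) = 1"
    by (simp only: exp_2pi_eq_1_iff)
  moreover have "2 * of_real pi * \<i> * of_nat N * of_real ((a + m) \<bullet> (b + k)) =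
    2 * of_real pi * \<i> * of_nat N * of_real (a \<bullet> b) +
    2 * of_real pi * \<i> * of_real (of_nat N * (b \<bullet> m) + of_nat N * ((a + m) \<bullet> k))"
    by (simp add: inner_add_left inner_add_right inner_commute[of b m] algebra_simps)
  ultimately show ?thesis
    by (simp add: exp_add)
qed

lemma d_pairing_period_pt:
  assumes "level_coord N a" "level_coord N b" "level_coord N e" "level_coord N f"
  shows "d_pairing \<pi> \<tau> N (\<pi> (period_pt \<tau> a b)) (\<pi> (period_pt \<tau> e f)) =
    exp (2 * of_real pi * \<i> * of_nat N * of_real (e \<bullet> b))"
  unfolding d_pairing_def
proof (rule the_equality)
  show "\<exists>a' b' e' f'. level_coord N a' \<and> level_coord N b' \<and> level_coord N e' \<and> level_coord N f' \<and>
     \<pi> (period_pt \<tau> a b) = \<pi> (period_pt \<tau> a' b') \<and> \<pi> (period_pt \<tau> e f) = \<pi> (period_pt \<tau> e' f') \<and>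
     exp (2 * of_real pi * \<i> * of_nat N * of_real (e \<bullet> b)) =
     exp (2 * of_real pi * \<i> * of_nat N * of_real (e' \<bullet> b'))"
    using assms by blast
next
  fix c
  assume "\<exists>a' b' e' f'. level_coord N a' \<and> level_coord N b' \<and> level_coord N e' \<and> level_coord N f' \<and>
     \<pi> (period_pt \<tau> a b) = \<pi> (period_pt \<tau> a' b') \<and> \<pi> (period_pt \<tau> e f) = \<pi> (period_pt \<tau> e' f') \<and>
     c = exp (2 * of_real pi * \<i> * of_nat N * of_real (e' \<bullet> b'))"
  then obtain a' b' e' f' where *: "level_coord N b'" "level_coord N e'"
    "\<pi> (period_pt \<tau> a b) = \<pi> (period_pt \<tau> a' b')" "\<pi> (period_pt \<tau> e f) = \<pi> (period_pt \<tau> e' f')"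
    "c = exp (2 * of_real pi * \<i> * of_nat N * of_real (e' \<bullet> b'))" by blast
  obtain m k where 1: "b = b' + k" "int_coord k"
    using *(3) by (rule pi_period_pt_eqE)
  obtain m k' where 2: "e = e' + m" "int_coord m"
    using *(4) by (rule pi_period_pt_eqE)
  show "c = exp (2 * of_real pi * \<i> * of_nat N * of_real (e \<bullet> b))"
    using exp_level_cong[OF *(2,1) 2(2) 1(2)] 1 2 *(5) by simp
qed

lemma d_transp_period_pt:
  assumes "level_coord N a" "level_coord N b" "level_coord N e" "level_coord N f"
  shows "d_transp \<pi> \<tau> N (\<pi> (period_pt \<tau> a b)) (\<pi> (period_pt \<tau> e f)) =
    exp (- (2 * of_real pi * \<i> * of_nat N * of_real (a \<bullet> f)))"
  using assms by (simp add: d_transp_def d_pairing_period_pt exp_minus)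

lemma pi_period_pt_add:
  "cls_add (\<pi> (period_pt \<tau> a b)) (\<pi> (period_pt \<tau> e f)) = \<pi> (period_pt \<tau> (a + e) (b + f))"
  by (simp add: period_pt_add pi_add)

text \<open>For u = \<tau>a + b and v = \<tau>e + f the quotient of the two values is exp(-2 pi i N
  (a . f - e . b)), and a . f - b . e is E(u, v). The values are N-th roots of unity because N f is
  integral and N a too.\<close>

lemma splits_d_transp: "splits_weil_pairing \<pi> E N (d_transp \<pi> \<tau> N)"
  unfolding splits_weil_pairing_def
proof (intro conjI ballI allI impI)
  fix P Q assume "P \<in> jac_torsion N \<pi>" "Q \<in> jac_torsion N \<pi>"
  then obtain a b e f where P: "level_coord N a" "level_coord N b" "P = \<pi> (period_pt \<tau> a b)"
    and Q: "level_coord N e" "level_coord N f" "Q = \<pi> (period_pt \<tau> e f)"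
    by (metis torsion_cases)
  have "exp (- (2 * of_real pi * \<i> * of_nat N * of_real (a \<bullet> f))) ^ N =
    inverse (exp (2 * of_real pi * \<i> * of_real (a \<bullet> (of_nat N *\<^sub>R f))) ^ N)"
    by (simp add: exp_minus power_inverse mult_ac)
  also have "\<dots> = 1"
    using exp_level[OF P(1), of "of_nat N *\<^sub>R f"] Q(2) by (simp add: level_coord_def)
  finally show "d_transp \<pi> \<tau> N P Q ^ N = 1"
    using P Q by (simp add: d_transp_period_pt)
  fix R assume "R \<in> jac_torsion N \<pi>"
  then obtain s t where R: "level_coord N s" "level_coord N t" "R = \<pi> (period_pt \<tau> s t)"
    by (rule torsion_cases)
  show "d_transp \<pi> \<tau> N (cls_add P Q) R = d_transp \<pi> \<tau> N P R * d_transp \<pi> \<tau> N Q R"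
    "d_transp \<pi> \<tau> N R (cls_add P Q) = d_transp \<pi> \<tau> N R P * d_transp \<pi> \<tau> N R Q"
    using P Q R
    by (simp_all add: pi_period_pt_add d_transp_period_pt level_coord_add inner_add_left inner_add_right
        algebra_simps flip: exp_add)
next
  fix u v assume "\<pi> u \<in> jac_torsion N \<pi> \<and> \<pi> v \<in> jac_torsion N \<pi>"
  then obtain a b e f where "level_coord N a" "level_coord N b" "u = period_pt \<tau> a b"
    and "level_coord N e" "level_coord N f" "v = period_pt \<tau> e f"
    by (metis torsionE)
  then show "exp (- 2 * of_real pi * \<i> * of_nat N * of_real (E u v)) =
      d_transp \<pi> \<tau> N (\<pi> u) (\<pi> v) / d_transp \<pi> \<tau> N (\<pi> v) (\<pi> u)"
    by (simp add: d_transp_period_pt E_period_pt inner_commute[of b e] algebra_simps flip: exp_diff)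
qed

text \<open>Both arguments are classes, so coordinates of P and a lift of x are chosen. For torsion
  P the choices do not matter, by \<open>num_add_Ints\<close> and \<open>quot_periodic\<close>. The
  value \<open>None\<close> off the range of \<open>X\<close> is what \<open>rational_on_X\<close>
  requires of the domain.\<close>

definition weil_fun :: "'n divisor set \<Rightarrow> 'n jac_fun" where
  "weil_fun P x = (if x \<in> range X then
     (let (a, b) = (SOME (a, b). level_coord N a \<and> level_coord N b \<and> P = \<pi> (period_pt \<tau> a b))
      in quot a b (SOME z. x = X z))
     else None)"

lemma weil_fun_period_pt:
  assumes "level_coord N a" "level_coord N b"
  shows "weil_fun (\<pi> (period_pt \<tau> a b)) (X z) = quot a b z"
proof -
  let ?Q = "\<lambda>(a', b'). level_coord N a' \<and> level_coord N b' \<and> \<pi> (period_pt \<tau> a b) = \<pi> (period_pt \<tau> a' b')"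
  obtain a' b' where ab: "Eps ?Q = (a', b')" by (cases "Eps ?Q")
  have "?Q (Eps ?Q)"
    by (rule someI[of ?Q "(a, b)"]) (use assms in simp)
  then have ab': "level_coord N a'" "level_coord N b'" "\<pi> (period_pt \<tau> a b) = \<pi> (period_pt \<tau> a' b')"
    by (auto simp: ab)
  define w where "w = (SOME w. X z = X w)"
  have "X z = X w" unfolding w_def by (rule someI[of _ z]) simp
  then obtain m k where "z = w + period_pt \<tau> m k" "int_coord m" "int_coord k"
    unfolding X_eq_iff by (rule pi_eqE)
  then have "quot a b z = quot a b w"
    using quot_periodic[OF assms] by simp
  moreover have "quot a b = quot a' b'"
  proof -
    obtain m k where mk: "a = a' + m" "b = b' + k" "int_coord m" "int_coord k"
      using ab'(3) by (rule pi_period_pt_eqE)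
    have "num a b = num a' b'"
      unfolding mk(1,2) by (rule ext) (rule num_add_Ints[OF ab'(1) mk(3,4)])
    then show ?thesis
      by (simp only: quot_def)
  qed
  ultimately show ?thesis
    by (simp add: weil_fun_def ab w_def)
qed

lemma weil_fun_domE:
  assumes "weil_fun P x = Some c"
  obtains z where "x = X z"
  using assms by (auto simp: weil_fun_def split: if_splits)

text \<open>One global choice of local equations serves every point: \<theta> for the theta divisor,
  its translate for the translated divisor, and the N-th power of \<open>unit\<close> as the nowhere
  vanishing factor.\<close>

lemma weil_function_weil_fun:
  assumes "level_coord N a" "level_coord N b"
  shows "weil_function C \<pi> \<delta> N (\<pi> (period_pt \<tau> a b)) (weil_fun (\<pi> (period_pt \<tau> a b)))"
proof -
  let ?p = "period_pt \<tau> a b" and ?T = "Theta_divisor C CARD('g)"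
  have theta: "reduced_equation {w. X w \<in> ?T} UNIV \<theta>"
    using delta(2) by (simp add: riemann_theta_characteristic_def)
  have "{w. X w \<in> translate_set (\<pi> ?p) ?T} = {w. w - ?p \<in> {w. X w \<in> ?T}}"
    by (simp add: translate_set_def X_diff)
  then have "reduced_equation {w. X w \<in> translate_set (\<pi> ?p) ?T} UNIV (\<lambda>w. \<theta> (w - ?p))"
    using reduced_equation_translate[OF theta, of ?p] by simp
  moreover have "weil_fun (\<pi> ?p) (X w) = Some (unit a b w ^ N * \<theta> (w - ?p) ^ N / \<theta> w ^ N)"
    if "\<theta> w \<noteq> 0" for w
    using quot_nonzero[OF that] by (simp add: weil_fun_period_pt[OF assms] num_eq)
  moreover have "holo_on (\<lambda>w. unit a b w ^ N) UNIV" "\<forall>w\<in>UNIV. unit a b w ^ N \<noteq> 0"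
    using holo_on_power[OF holo_unit] by (simp_all add: unit_def)
  moreover have "rational_on_X \<pi> \<delta> (weil_fun (\<pi> ?p))"
    unfolding rational_on_X_def weil_fun_period_pt[OF assms]
    using meromorphic_map_quot[of a b] by (auto elim: weil_fun_domE)
  ultimately show ?thesis
    unfolding weil_function_def Let_def using theta by blast
qed

lemma weil_fun_mult:
  assumes ab: "level_coord N a" "level_coord N b" and ef: "level_coord N e" "level_coord N f"
    and "weil_fun (\<pi> (period_pt \<tau> a b)) x = Some c1"
      "weil_fun (\<pi> (period_pt \<tau> e f)) (cls_diff x (\<pi> (period_pt \<tau> a b))) = Some c2"
      "weil_fun (\<pi> (period_pt \<tau> (a + e) (b + f))) x = Some c3"
  shows "c1 * c2 = d_transp \<pi> \<tau> N (\<pi> (period_pt \<tau> a b)) (\<pi> (period_pt \<tau> e f)) * c3"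
proof -
  obtain z where z: "x = X z" using assms(5) by (rule weil_fun_domE)
  show ?thesis
    using assms(5-) quot_mult[of a b z c1 e f c2 c3]
    by (simp add: z X_diff weil_fun_period_pt ab ef level_coord_add d_transp_period_pt)
qed

text \<open>The inversion relation is the product relation for the pair (-P, P): its right-hand side
  is a scalar times the function of the zero class, which is the constant 1.\<close>

lemma normal_weil_fun: "normal_weil_set C \<pi> E \<delta> N (d_transp \<pi> \<tau> N) weil_fun"
  unfolding normal_weil_set_def
proof (intro conjI ballI)
  show "weil_set C \<pi> \<delta> N weil_fun"
    unfolding weil_set_def using weil_function_weil_fun by (auto elim!: torsion_cases)
  show "splits_weil_pairing \<pi> E N (d_transp \<pi> \<tau> N)"
    by (rule splits_d_transp)
next
  fix P Q assume "P \<in> jac_torsion N \<pi>" "Q \<in> jac_torsion N \<pi>"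
  then obtain a b e f where P: "level_coord N a" "level_coord N b" "P = \<pi> (period_pt \<tau> a b)"
    and Q: "level_coord N e" "level_coord N f" "Q = \<pi> (period_pt \<tau> e f)"
    by (metis torsion_cases)
  show "rat_agree (rat_mult (weil_fun P) (translate_fun P (weil_fun Q)))
      (rat_scale (d_transp \<pi> \<tau> N P Q) (weil_fun (cls_add P Q)))"
    using weil_fun_mult[OF P(1,2) Q(1,2)] P(3) Q(3)
    by (auto simp: rat_agree_def rat_mult_def rat_scale_def translate_fun_def pi_period_pt_add
        split: option.splits)
next
  fix P assume "P \<in> jac_torsion N \<pi>"
  then obtain a b where P: "level_coord N a" "level_coord N b" "P = \<pi> (period_pt \<tau> a b)"
    by (rule torsion_cases)
  let ?P' = "\<pi> (period_pt \<tau> (- a) (- b))"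
  have P': "cls_diff (\<pi> 0) P = ?P'"
    by (simp add: P pi_diff period_pt_minus)
  note m = level_coord_minus[OF P(1)] level_coord_minus[OF P(2)]
  have inv: "c1 = d_transp \<pi> \<tau> N P ?P' * inverse c2"
    if c: "weil_fun ?P' x = Some c1" "weil_fun P (cls_diff x ?P') = Some c2" "c2 \<noteq> 0" for x c1 c2
  proof -
    obtain z where z: "x = X z" using c(1) by (rule weil_fun_domE)
    have "weil_fun (\<pi> (period_pt \<tau> (- a + a) (- b + b))) x = Some 1"
      using quot_0[of z] weil_fun_period_pt[OF level_coord_0 level_coord_0] by (simp add: z)
    from weil_fun_mult[OF m P(1,2) c(1) _ this] c(2)
    have "c1 * c2 = d_transp \<pi> \<tau> N ?P' P"
      by (simp add: P)
    \<comment> \<open>Both scalars are exp(2 pi i N a . b), since the sign may sit on either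
      argument.\<close>
    also have "\<dots> = d_transp \<pi> \<tau> N P ?P'"
      by (simp add: P d_transp_period_pt[OF m P(1,2)] d_transp_period_pt[OF P(1,2) m])
    finally show ?thesis
      using c(3) by (simp add: field_simps)
  qed
  show "let P' = cls_diff (\<pi> 0) P in rat_agree (weil_fun P')
      (rat_scale (d_transp \<pi> \<tau> N P P') (rat_inverse (translate_fun P' (weil_fun P))))"
    unfolding Let_def P' rat_agree_def
  proof
    fix x assume "x \<in> dom (weil_fun ?P') \<inter>
      dom (rat_scale (d_transp \<pi> \<tau> N P ?P') (rat_inverse (translate_fun ?P' (weil_fun P))))"
    then obtain c1 c2 where c: "weil_fun ?P' x = Some c1" "weil_fun P (cls_diff x ?P') = Some c2" "c2 \<noteq> 0"
      by (auto simp: rat_inverse_def rat_scale_def translate_fun_def split: option.splits if_splits)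
    then show "weil_fun ?P' x =
        rat_scale (d_transp \<pi> \<tau> N P ?P') (rat_inverse (translate_fun ?P' (weil_fun P))) x"
      using inv[OF c] by (simp add: rat_inverse_def rat_scale_def translate_fun_def)
  qed
qed

lemma weil_fun_theta:
  assumes "level_coord N a" "level_coord N b" "\<theta> z \<noteq> 0"
  shows "weil_fun (\<pi> (period_pt \<tau> a b)) (X z) =
    Some ((theta_char (- a) (- b) z \<tau> / \<theta> z) ^ N)"
  using quot_nonzero[OF assms(3)] by (simp add: weil_fun_period_pt assms num_def power_divide)

end

theorem theorem8p3:
  fixes C :: "(complex^'n) set set"
    and K :: "'n divisor"
    and \<pi> :: "complex^'g \<Rightarrow> 'n divisor set"
    and E :: "complex^'g \<Rightarrow> complex^'g \<Rightarrow> real"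
    and \<tau> :: "complex^'g^'g"
    and \<delta> :: "'n divisor set"
    and N :: nat
  assumes curve: "smooth_projective_curve C"
    and genus: "has_genus C CARD('g)" "CARD('g) \<ge> 2"
    and N: "N \<ge> 2" "even N"
    and K: "canonical_divisor C K"
    and jacobian: "jacobian_uniformization C \<pi>"
    and periods: "theta_polarization C \<pi> E" "symplectic_period_matrix \<pi> E \<tau>"
    and delta: "\<delta> \<in> Jac C (int CARD('g) - 1)" "even_theta_characteristic C K \<delta>"
      "riemann_theta_characteristic C \<pi> \<tau> \<delta>"
  shows "\<exists>f. normal_weil_set C \<pi> E \<delta> N (d_transp \<pi> \<tau> N) f \<and>
    (\<forall>a b. level_coord N a \<and> level_coord N b \<longrightarrow>
       (\<forall>z. theta_char 0 0 z \<tau> \<noteq> 0 \<longrightarrow>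
          f (\<pi> (period_pt \<tau> a b)) (X_cover \<pi> \<delta> z) =
            Some ((theta_char (- a) (- b) z \<tau> / theta_char 0 0 z \<tau>) ^ N))) \<and>
    (\<forall>w. length w = 3 * CARD('g) - 3 \<and> set w \<subseteq> C \<and>
         sum_class C w = cls_add (div_class C K) \<delta> \<and> theta_char 0 0 0 \<tau> \<noteq> 0 \<longrightarrow>
       (\<forall>a b. level_coord N a \<and> level_coord N b \<longrightarrow>
          sum_pullback C K (f (\<pi> (period_pt \<tau> a b))) w =
            Some ((theta_char (- a) (- b) 0 \<tau> / theta_char 0 0 0 \<tau>) ^ N)))"
proof -
  interpret jacobian_theta C \<pi> E \<tau> \<delta> N "int CARD('g) - 1"
    using assms by unfold_locales simp_all
  have "divisor_on C K" using K by (simp add: canonical_divisor_def)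
  note cls = cls_diff_cls_add[OF this]
  show ?thesis
  proof (intro exI conjI allI impI; (elim conjE)?)
    show "normal_weil_set C \<pi> E \<delta> N (d_transp \<pi> \<tau> N) weil_fun"
      by (rule normal_weil_fun)
  next
    fix a b :: "real^'g" and z assume "level_coord N a" "level_coord N b" "\<theta> z \<noteq> 0"
    then show "weil_fun (\<pi> (period_pt \<tau> a b)) (X z) =
        Some ((theta_char (- a) (- b) z \<tau> / \<theta> z) ^ N)"
      by (rule weil_fun_theta)
  next
    fix w and a b :: "real^'g"
    assume "sum_class C w = cls_add (div_class C K) \<delta>" "\<theta> 0 \<noteq> 0" "level_coord N a" "level_coord N b"
    \<comment> \<open>Subtracting the class of K from the class of w leaves \<delta> =
      \<open>X 0\<close>, so the evaluation on the curve is the theta formula at z = 0.\<close>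
    then show "sum_pullback C K (weil_fun (\<pi> (period_pt \<tau> a b))) w =
        Some ((theta_char (- a) (- b) 0 \<tau> / \<theta> 0) ^ N)"
      using weil_fun_theta[of a b 0] by (simp add: sum_pullback_def cls X_0)
  qed
qed

end
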